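(* Let $G$ be a finite, connected, simple undirected graph with vertices $v_0,\dots,v_n$ and edge set $E$, with sink $v_0$. Let $\lambda_0$ be the Pak–Stanley labeling of the regions of the $(G,v_0)$-semiorder arrangement and $\widetilde{\mathcal{R}}_0$ its set of admissible regions (both defined in the context). Then $$\lambda_0(\widetilde{\mathcal{R}}_0)=\widetilde{\mathcal{S}}_0=\{c-v_0:\ c \text{ a superstable configuration on } G\}.$$
   Context: Divisors are elements of $\mathbb{Z}V$, $V=\{v_0,\dots,v_n\}$; configurations on $G$ (sink $v_0$) are elements of $\mathbb{Z}(V\setminus\{v_0\})$; inequalities are componentwise. For a graph $H$ with sink, a configuration $c\ge0$ is superstable if no nonempty set $Y$ of nonsink vertices has $c-\widetilde{\Delta}1_Y\ge0$, $\widetilde\Delta$ being the Laplacian $D-A$ of $H$ with the sink's row and column removed. $K(G)$ is $G$ plus a new sink $\tilde q$ adjacent to every vertex of $V$; $\mathcal{S}=\{c\in\mathbb{Z}V: c+\sum_{v\in V}v\text{ superstable on }K(G)\}$ and $\widetilde{\mathcal{S}}_0=\{c\in\mathcal{S}:c_{v_0}=-1,\ c+v_0\ge0\}$. The $(G,v_0)$-semiorder arrangement $\mathscr{I}_0$ is the set of hyperplanes $x_i-x_j=1$ in $\mathbb{R}^n$ (coordinates $x_1,\dots,x_n$) for ordered pairs $i\neq j$, both nonzero, with $\{v_i,v_j\}\in E$; its regions are the connected components of the complement. Labeling $\lambda_0$: label the central region ($|x_i-x_j|<1$ for all distinct nonzero $i,j$ with $\{v_i,v_j\}\in E$) by the divisor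 assigning $0$ to each $v_i$ adjacent to $v_0$ and $-1$ to all other vertices including $v_0$, and queue it; while the queue is nonempty, remove its first region $r$, and for each unlabeled region $r'$ bordering $r$, determine the unique $i\neq j$ with $|x_i-x_j|<1$ on $r$ and $x_j>x_i+1$ on $r'$, label $r'$ by (label of $r$)$+v_j$ and queue $r'$. Admissible regions: for $i=1,\dots,n$ let $\mathbb{R}^n_{(i,0)}=\mathbb{R}^n$ if $\{v_i,v_0\}\in E$, and otherwise $\mathbb{R}^n_{(i,0)}=\{x\in\mathbb{R}^n: x_i>x_j+1 \text{ for some } j \text{ with }\{v_i,v_j\}\in E\}$; let $\widetilde{\mathbb{R}}^n=\bigcap_{i=1}^n\mathbb{R}^n_{(i,0)}$. The admissible regions $\widetilde{\mathcal{R}}_0$ are the connected components of $\widetilde{\mathbb{R}}^n$ minus the union of the hyperplanes of $\mathscr{I}_0$. *)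

theory Defs
  imports "HOL-Analysis.Analysis"
begin

text \<open>
  A graph is given by its edge set over a finite vertex type \<open>'v\<close>; all of \<open>'v\<close> is the vertex set.
  A graph with vertices \<open>v\<^sub>0, \<dots>, v\<^sub>n\<close> thus has \<open>CARD('v) = n + 1\<close>, and \<open>n = 0\<close> is allowed.
  The sink \<open>v\<^sub>0\<close> is a distinguished vertex \<open>q\<close>.
\<close>

definition simple_graph :: "'v set set \<Rightarrow> bool" where
  "simple_graph E \<longleftrightarrow> (\<forall>e\<in>E. card e = 2)"

definition connected_graph :: "'v set set \<Rightarrow> bool" where
  "connected_graph E \<longleftrightarrow> (\<forall>u v. (u, v) \<in> {(a, b). {a, b} \<in> E}\<^sup>*)"


section \<open>Divisors, configurations and superstability\<close>

text \<open>
  A divisor is an element of \<open>int ^ 'v\<close>, the vertex \<open>v\<close> itself being \<open>axis v 1\<close>. A configuration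
  is a divisor whose coefficient at the sink is zero. The order on vectors is componentwise.
\<close>

definition degree_matrix :: "'v::finite set set \<Rightarrow> int ^ 'v ^ 'v" where
  "degree_matrix E = (\<chi> u v. if u = v then int (card {w. {u, w} \<in> E}) else 0)"

definition adjacency_matrix :: "'v::finite set set \<Rightarrow> int ^ 'v ^ 'v" where
  "adjacency_matrix E = (\<chi> u v. if {u, v} \<in> E then 1 else 0)"

definition laplacian :: "'v::finite set set \<Rightarrow> int ^ 'v ^ 'v" where
  "laplacian E = degree_matrix E - adjacency_matrix E"

text \<open>
  The row and column of the sink are filled with zeros instead of being removed. On
  configurations, whose sink coefficient is zero, this is the same operator.
\<close>

definition reduced_laplacian :: "'v::finite set set \<Rightarrow> 'v \<Rightarrow> int ^ 'v ^ 'v" where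
  "reduced_laplacian E q = (\<chi> u v. if u = q \<or> v = q then 0 else laplacian E $ u $ v)"

definition superstable :: "'v::finite set set \<Rightarrow> 'v \<Rightarrow> int ^ 'v \<Rightarrow> bool" where
  "superstable E q c \<longleftrightarrow> c $ q = 0 \<and> 0 \<le> c \<and>
     \<not> (\<exists>Y. Y \<noteq> {} \<and> Y \<subseteq> - {q} \<and>
          0 \<le> c - reduced_laplacian E q *v (\<chi> v. if v \<in> Y then 1 else 0))"

text \<open>The graph \<open>K(G)\<close> has vertex type \<open>'v option\<close>; its sink is \<open>None\<close>.\<close>

definition cone_edges :: "'v set set \<Rightarrow> 'v option set set" where
  "cone_edges E = (\<lambda>e. Some ` e) ` E \<union> {{None, Some v} | v. True}"

definition cone_config :: "int ^ 'v::finite \<Rightarrow> int ^ 'v option" where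
  "cone_config c = (\<chi> w. case w of None \<Rightarrow> 0 | Some v \<Rightarrow> c $ v)"

definition S_set :: "'v::finite set set \<Rightarrow> (int ^ 'v) set" where
  "S_set E = {c. superstable (cone_edges E) None (cone_config (c + (\<Sum>v\<in>UNIV. axis v 1)))}"

definition S0_tilde :: "'v::finite set set \<Rightarrow> 'v \<Rightarrow> (int ^ 'v) set" where
  "S0_tilde E q = {c \<in> S_set E. c $ q = -1 \<and> 0 \<le> c + axis q 1}"


section \<open>The semiorder arrangement\<close>

text \<open>
  The space \<open>\<real>\<^sup>n\<close> with coordinates indexed by the nonsink vertices is realised as the coordinate
  subspace of \<open>real ^ 'v\<close> in which the sink coordinate vanishes.
\<close>

definition nonsink_space :: "'v::finite \<Rightarrow> (real ^ 'v) set" where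
  "nonsink_space q = {x. x $ q = 0}"

definition semiorder_arrangement :: "'v::finite set set \<Rightarrow> 'v \<Rightarrow> (real ^ 'v) set set" where
  "semiorder_arrangement E q =
     {{x \<in> nonsink_space q. x $ i - x $ j = 1} | i j.
        i \<noteq> q \<and> j \<noteq> q \<and> i \<noteq> j \<and> {i, j} \<in> E}"

definition regions :: "'v::finite set set \<Rightarrow> 'v \<Rightarrow> (real ^ 'v) set set" where
  "regions E q = components (nonsink_space q - \<Union>(semiorder_arrangement E q))"

definition central_region :: "'v::finite set set \<Rightarrow> 'v \<Rightarrow> (real ^ 'v) set" where
  "central_region E q = {x \<in> nonsink_space q.
     \<forall>i j. i \<noteq> q \<and> j \<noteq> q \<and> i \<noteq> j \<and> {i, j} \<in> E \<longrightarrow> \<bar>x $ i - x $ j\<bar> < 1}"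

text \<open>Two regions border each other if their closures meet in codimension one.\<close>

definition bordering :: "'v::finite \<Rightarrow> (real ^ 'v) set \<Rightarrow> (real ^ 'v) set \<Rightarrow> bool" where
  "bordering q r r' \<longleftrightarrow> r \<noteq> r' \<and>
     aff_dim (closure r \<inter> closure r') = aff_dim (nonsink_space q) - 1"

definition admissible_space :: "'v::finite set set \<Rightarrow> 'v \<Rightarrow> (real ^ 'v) set" where
  "admissible_space E q = nonsink_space q \<inter>
     (\<Inter>i\<in>- {q}. if {i, q} \<in> E then nonsink_space q
        else {x \<in> nonsink_space q. \<exists>j. {i, j} \<in> E \<and> x $ i > x $ j + 1})"

definition admissible_regions :: "'v::finite set set \<Rightarrow> 'v \<Rightarrow> (real ^ 'v) set set" where
  "admissible_regions E q =
     components (admissible_space E q - \<Union>(semiorder_arrangement E q))"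


section \<open>The Pak--Stanley labeling\<close>

definition central_label :: "'v::finite set set \<Rightarrow> 'v \<Rightarrow> int ^ 'v" where
  "central_label E q = (\<chi> v. if {v, q} \<in> E then 0 else -1)"

definition crossing_pair :: "'v::finite \<Rightarrow> (real ^ 'v) set \<Rightarrow> (real ^ 'v) set \<Rightarrow> 'v \<times> 'v" where
  "crossing_pair q r r' = (THE (i, j). i \<noteq> q \<and> j \<noteq> q \<and> i \<noteq> j \<and>
     (\<forall>x\<in>r. \<bar>x $ i - x $ j\<bar> < 1) \<and> (\<forall>x\<in>r'. x $ j > x $ i + 1))"

text \<open>
  The state of the labeling algorithm consists of the queue and the partial labeling found so far.
  One step removes the first region of the queue, labels all unlabeled regions bordering it, and
  appends these to the queue in an arbitrary order \<open>rs\<close>.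
\<close>

type_synonym 'v labeling = "(real ^ 'v) set \<rightharpoonup> int ^ 'v"
type_synonym 'v ps_state = "(real ^ 'v) set list \<times> 'v labeling"

inductive ps_step :: "'v::finite set set \<Rightarrow> 'v \<Rightarrow> 'v ps_state \<Rightarrow> 'v ps_state \<Rightarrow> bool"
  for E :: "'v set set" and q :: 'v where
  "\<lbrakk>distinct rs; set rs = {r' \<in> regions E q. bordering q r r' \<and> L r' = None}\<rbrakk> \<Longrightarrow>
   ps_step E q (r # Q, L)
     (Q @ rs, \<lambda>r'. if r' \<in> set rs
                     then Some (the (L r) + axis (snd (crossing_pair q r r')) 1)
                     else L r')"

definition ps_init :: "'v::finite set set \<Rightarrow> 'v \<Rightarrow> 'v ps_state" where
  "ps_init E q = ([central_region E q], [central_region E q \<mapsto> central_label E q])"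

text \<open>
  The labeling present when the queue has become empty; it does not depend on the orders chosen
  in the individual steps.
\<close>

definition final_labeling :: "'v::finite set set \<Rightarrow> 'v \<Rightarrow> 'v labeling" where
  "final_labeling E q = (THE L. (ps_step E q)\<^sup>*\<^sup>* (ps_init E q) ([], L))"

definition pak_stanley_label :: "'v::finite set set \<Rightarrow> 'v \<Rightarrow> (real ^ 'v) set \<Rightarrow> int ^ 'v" where
  "pak_stanley_label E q r = the (final_labeling E q r)"

end

theory Submission
  imports Defs
begin

text \<open>
  Off the hyperplanes, a point \<open>x\<close> determines the digraph of arcs \<open>i \<rightarrow> j\<close> along the edges with
  \<open>x\<^sub>j > x\<^sub>i + 1\<close>, and a region is the convex set of points with a given digraph. Since the
  number of arcs is the distance from the central region, the breadth-first search only ever adds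
  arcs, and the label of a region is the central label plus the indegrees of its digraph.

  Labels of admissible regions are superstable: in a set \<open>Y\<close> of nonsink vertices, one that
  minimises \<open>x\<close> receives no arc from within \<open>Y\<close>. Conversely, given a superstable configuration,
  sweep a time \<open>t\<close> from left to right and place a vertex \<open>v\<close> at \<open>t\<close> as soon as the required number
  of its neighbours lie to the left of \<open>t - 1\<close>. Superstability means that the sweep never
  gets stuck.
\<close>

section \<open>Superstability on a graph and on its cone\<close>

lemma edge_neq:
  assumes "simple_graph E" "{u, v} \<in> E"
  shows "u \<noteq> v"
  using assms by (auto simp: simple_graph_def)

text \<open>Firing \<open>Y\<close> moves chips only along the edges leaving \<open>Y\<close>:
  within \<open>Y\<close> the neighbours counted by the degree cancel against those counted by the
  adjacency terms.\<close>

lemma reduced_laplacian_mult_indicator: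
  assumes "simple_graph E" "Y \<subseteq> - {q}"
  shows "(reduced_laplacian E q *v (\<chi> v. if v \<in> Y then 1 else 0)) $ u =
    (if u \<in> Y then int (card {w. w \<notin> Y \<and> {u, w} \<in> E})
     else if u = q then 0 else - int (card {w. w \<in> Y \<and> {u, w} \<in> E}))"
proof -
  have "(reduced_laplacian E q *v (\<chi> v. if v \<in> Y then 1 else 0)) $ u
      = (\<Sum>w\<in>UNIV. if w \<in> Y then reduced_laplacian E q $ u $ w else 0)"
    by (auto simp: matrix_vector_mult_def intro!: sum.cong)
  also have "\<dots> = (\<Sum>w\<in>Y. reduced_laplacian E q $ u $ w)"
    by (simp add: sum.If_cases)
  also have "\<dots> = (if u = q then 0 else (\<Sum>w\<in>Y. laplacian E $ u $ w))"
    using assms(2) by (auto simp: reduced_laplacian_def intro!: sum.cong sum.neutral)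
  also have "(\<Sum>w\<in>Y. laplacian E $ u $ w)
      = (\<Sum>w\<in>Y. if u = w then int (card {w. {u, w} \<in> E}) else 0)
        - (\<Sum>w\<in>Y. if {u, w} \<in> E then 1 else 0)"
    by (simp add: laplacian_def degree_matrix_def adjacency_matrix_def sum_subtractf)
  also have "(\<Sum>w\<in>Y. if u = w then int (card {w. {u, w} \<in> E}) else 0)
      = (if u \<in> Y then int (card {w. {u, w} \<in> E}) else 0)"
    by simp
  also have "(\<Sum>w\<in>Y. if {u, w} \<in> E then 1 else (0::int)) = int (card {w. w \<in> Y \<and> {u, w} \<in> E})"
    by (simp add: sum.If_cases Int_def)
  also have "card {w. {u, w} \<in> E} =
      card {w. w \<in> Y \<and> {u, w} \<in> E} + card {w. w \<notin> Y \<and> {u, w} \<in> E}"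
    by (subst card_Un_disjoint [symmetric]) (auto intro: arg_cong [where f = card])
  finally show ?thesis
    using assms(2) by auto
qed

text \<open>Vertices outside \<open>Y\<close> only gain chips when \<open>Y\<close> is fired, so for
  nonnegative \<open>c\<close> the legality of the firing is decided on \<open>Y\<close>
  alone.\<close>

lemma superstable_iff:
  assumes "simple_graph E"
  shows "superstable E q c \<longleftrightarrow> c $ q = 0 \<and> (\<forall>v. 0 \<le> c $ v) \<and>
    (\<forall>Y. Y \<noteq> {} \<longrightarrow> Y \<subseteq> - {q} \<longrightarrow>
       (\<exists>v\<in>Y. c $ v < int (card {w. w \<notin> Y \<and> {v, w} \<in> E})))"
proof -
  define legal where
    "legal Y \<longleftrightarrow> 0 \<le> c - reduced_laplacian E q *v (\<chi> v. if v \<in> Y then 1 else 0)" for Y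
  have legal: "legal Y \<longleftrightarrow> \<not> (\<exists>v\<in>Y. c $ v < int (card {w. w \<notin> Y \<and> {v, w} \<in> E}))"
    if "\<forall>v. 0 \<le> c $ v" "Y \<subseteq> - {q}" for Y
  proof -
    have "0 \<le> c $ v + int k" for v k
      using that(1) by (simp add: add_nonneg_nonneg)
    then show ?thesis
      using that by (auto simp: legal_def less_eq_vec_def not_less
        reduced_laplacian_mult_indicator [OF assms] intro: order_trans [of _ 0])
  qed
  have "superstable E q c \<longleftrightarrow> c $ q = 0 \<and> (\<forall>v. 0 \<le> c $ v) \<and>
      (\<forall>Y. Y \<noteq> {} \<longrightarrow> Y \<subseteq> - {q} \<longrightarrow> \<not> legal Y)"
    unfolding superstable_def legal_def less_eq_vec_def [of 0 c] zero_index by blast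
  with legal show ?thesis by (simp cong: conj_cong imp_cong)
qed

section \<open>Superstability on the cone\<close>

lemma simple_graph_cone_edges:
  assumes "simple_graph E"
  shows "simple_graph (cone_edges E)"
  using assms by (auto simp: simple_graph_def cone_edges_def card_image)

lemma cone_edges_Some_Some [simp]: "{Some u, Some v} \<in> cone_edges E \<longleftrightarrow> {u, v} \<in> E"
proof -
  have "{Some u, Some v} = Some ` e \<longleftrightarrow> e = {u, v}" for e
    by (metis image_insert image_empty inj_Some inj_image_eq_iff)
  then show ?thesis
    by (auto simp: cone_edges_def image_iff doubleton_eq_iff)
qed

lemma cone_edges_None [simp]: "{Some u, None} \<in> cone_edges E"
  by (auto simp: cone_edges_def)

text \<open>On the cone every vertex has exactly one additional neighbour, \<open>None\<close>,
  which lies outside every set to be fired; this extra neighbour cancels the one added to each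
  coefficient. No vertex of the original graph is excluded from \<open>Y\<close>.\<close>

lemma S_set_iff:
  fixes E :: "'v::finite set set"
  assumes "simple_graph E"
  shows "c \<in> S_set E \<longleftrightarrow> (\<forall>v. -1 \<le> c $ v) \<and>
    (\<forall>Y. Y \<noteq> {} \<longrightarrow> (\<exists>v\<in>Y. c $ v < int (card {w. w \<notin> Y \<and> {v, w} \<in> E})))"
proof -
  have one: "(\<Sum>v\<in>UNIV. axis v 1) $ u = (1::int)" for u :: 'v
    by (simp add: axis_def)
  have card: "card {w. w \<notin> Some ` Y \<and> {Some v, w} \<in> cone_edges E} =
      Suc (card {w. w \<notin> Y \<and> {v, w} \<in> E})" for Y and v :: 'v
  proof -
    have "{w. w \<notin> Some ` Y \<and> {Some v, w} \<in> cone_edges E}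
        = insert None (Some ` {w. w \<notin> Y \<and> {v, w} \<in> E})"
    proof (rule set_eqI)
      show "w \<in> {w. w \<notin> Some ` Y \<and> {Some v, w} \<in> cone_edges E} \<longleftrightarrow>
          w \<in> insert None (Some ` {w. w \<notin> Y \<and> {v, w} \<in> E})" for w
        by (cases w) auto
    qed
    then show ?thesis
      by (simp add: card_image)
  qed
  have sub: "Y \<noteq> {} \<and> Y \<subseteq> - {None} \<longleftrightarrow> (\<exists>Z. Z \<noteq> {} \<and> Y = Some ` Z)" for Y :: "'v option set"
  proof
    assume *: "Y \<noteq> {} \<and> Y \<subseteq> - {None}"
    then have "Y = Some ` {v. Some v \<in> Y}"
      by (auto simp: image_iff) (metis not_None_eq)
    with * show "\<exists>Z. Z \<noteq> {} \<and> Y = Some ` Z"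
      by (metis image_empty)
  qed auto
  have val: "cone_config (c + (\<Sum>v\<in>UNIV. axis v 1)) $ Some v = c $ v + 1"
    "cone_config (c + (\<Sum>v\<in>UNIV. axis v 1)) $ None = 0" for v
    using one by (simp_all add: cone_config_def)
  have nonneg: "(\<forall>w. 0 \<le> cone_config (c + (\<Sum>v\<in>UNIV. axis v 1)) $ w) \<longleftrightarrow> (\<forall>v. -1 \<le> c $ v)"
  proof -
    have "0 \<le> c $ v + 1 \<longleftrightarrow> -1 \<le> c $ v" for v by linarith
    then show ?thesis by (simp add: split_option_all val)
  qed
  have "(\<forall>Y. Y \<noteq> {} \<longrightarrow> Y \<subseteq> - {None} \<longrightarrow> P Y) \<longleftrightarrow> (\<forall>Z. Z \<noteq> {} \<longrightarrow> P (Some ` Z))"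
    for P :: "'v option set \<Rightarrow> bool"
    using sub by metis
  then show ?thesis
    by (simp add: S_set_def superstable_iff [OF simple_graph_cone_edges [OF assms]] nonneg val card)
qed

text \<open>If \<open>q\<close> is in \<open>Y\<close>, the coefficient -1 at \<open>q\<close>
  already satisfies the condition, since a cardinality is nonnegative. Only sets avoiding
  \<open>q\<close> remain, and on these \<open>c\<close> and \<open>c + axis q 1\<close>
  agree.\<close>

lemma S0_tilde_eq:
  fixes E :: "'v::finite set set"
  assumes "simple_graph E"
  shows "S0_tilde E q = {c - axis q 1 | c. superstable E q c}"
proof -
  have "c \<in> S0_tilde E q \<longleftrightarrow> superstable E q (c + axis q 1)" for c
  proof -
    have nn: "c $ q = -1 \<and> (\<forall>v. -1 \<le> c $ v) \<and> 0 \<le> c + axis q 1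
        \<longleftrightarrow> (c + axis q 1) $ q = 0 \<and> (\<forall>v. 0 \<le> (c + axis q 1) $ v)"
    proof -
      have "-1 \<le> c $ v" if "0 \<le> (c + axis q 1) $ v" for v
        using that by (auto simp: axis_def split: if_splits)
      then show ?thesis
        by (auto simp: less_eq_vec_def axis_def)
    qed
    have "(\<forall>Y. Y \<noteq> {} \<longrightarrow> (\<exists>v\<in>Y. c $ v < int (card {w. w \<notin> Y \<and> {v, w} \<in> E}))) \<longleftrightarrow>
        (\<forall>Y. Y \<noteq> {} \<longrightarrow> Y \<subseteq> - {q} \<longrightarrow>
          (\<exists>v\<in>Y. (c + axis q 1) $ v < int (card {w. w \<notin> Y \<and> {v, w} \<in> E})))"
      if "c $ q = -1"
    proof (intro iff_allI imp_cong refl)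
      fix Y
      show "(\<exists>v\<in>Y. c $ v < int (card {w. w \<notin> Y \<and> {v, w} \<in> E})) \<longleftrightarrow>
        (Y \<subseteq> - {q} \<longrightarrow>
          (\<exists>v\<in>Y. (c + axis q 1) $ v < int (card {w. w \<notin> Y \<and> {v, w} \<in> E})))"
      proof (cases "q \<in> Y")
        case True
        moreover have "\<exists>v\<in>Y. c $ v < int (card {w. w \<notin> Y \<and> {v, w} \<in> E})"
          using that True by (intro bexI [of _ q]) auto
        ultimately show ?thesis by auto
      next
        case False
        then have "(\<exists>v\<in>Y. (c + axis q 1) $ v < int (card {w. w \<notin> Y \<and> {v, w} \<in> E}))
          \<longleftrightarrow> (\<exists>v\<in>Y. c $ v < int (card {w. w \<notin> Y \<and> {v, w} \<in> E}))"
          by (intro bex_cong) (auto simp: axis_def)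
        with False show ?thesis by auto
      qed
    qed
    with nn show ?thesis
      unfolding S0_tilde_def mem_Collect_eq S_set_iff [OF assms] superstable_iff [OF assms]
      by blast
  qed
  moreover have "superstable E q (c + axis q 1) \<longleftrightarrow> (\<exists>c'. c = c' - axis q 1 \<and> superstable E q c')"
    for c by (metis add_diff_cancel_right' diff_add_cancel)
  ultimately show ?thesis by auto
qed

section \<open>Realising a configuration by a sweep\<close>

text \<open>\<open>B\<close> is the set of vertices placed up to time \<open>t\<close>, and
  \<open>d\<close> prescribes the indegrees. A placed vertex has met its demand exactly, a waiting
  one has not exceeded it. Injectivity of \<open>x\<close> makes the thresholds
  \<open>x i + 1\<close> distinct, so that passing one of them raises each count by at most
  one.\<close>

definition sweep_state ::
    "'v::finite set set \<Rightarrow> 'v set \<Rightarrow> ('v \<Rightarrow> nat) \<Rightarrow> 'v set \<Rightarrow> ('v \<Rightarrow> real) \<Rightarrow> real \<Rightarrow> bool" where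
  "sweep_state E N d B x t \<longleftrightarrow> B \<subseteq> N \<and> inj_on x B \<and> (\<forall>v\<in>B. x v \<le> t) \<and>
     (\<forall>v\<in>B. card {i \<in> B. {i, v} \<in> E \<and> x i + 1 < x v} = d v) \<and>
     (\<forall>v\<in>B. \<forall>i\<in>B. {i, v} \<in> E \<longrightarrow> x v \<noteq> x i + 1) \<and>
     (\<forall>v\<in>N - B. card {i \<in> B. {i, v} \<in> E \<and> x i + 1 \<le> t} \<le> d v)"

text \<open>Time jumps from one threshold \<open>x i + 1\<close> to the next until some waiting
  vertex has met its demand. The vertex \<open>v\<close> guarantees that this happens at the latest
  when all thresholds are passed; the induction is on the number of thresholds ahead.\<close>

lemma sweep_advance:
  assumes "sweep_state E N d B x t" and "v \<in> N - B"
    and "d v \<le> card {i \<in> B. {i, v} \<in> E}"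
  shows "\<exists>t'. sweep_state E N d B x t' \<and>
    (\<exists>w\<in>N - B. card {i \<in> B. {i, w} \<in> E \<and> x i + 1 \<le> t'} = d w)"
  using assms(1)
proof (induction "card {i \<in> B. t < x i + 1}" arbitrary: t rule: less_induct)
  case less
  note st = less.prems [unfolded sweep_state_def]
  show ?case
  proof (cases "{i \<in> B. t < x i + 1} = {}")
    case True
    then have "{i \<in> B. {i, v} \<in> E \<and> x i + 1 \<le> t} = {i \<in> B. {i, v} \<in> E}"
      by force
    moreover have "card {i \<in> B. {i, v} \<in> E \<and> x i + 1 \<le> t} \<le> d v"
      using st assms(2) by blast
    ultimately have "card {i \<in> B. {i, v} \<in> E \<and> x i + 1 \<le> t} = d v"
      using assms(3) by simp
    with less.prems assms(2) show ?thesis by blast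
  next
    case False
    \<comment> \<open>The vertex \<open>b\<close> has the earliest threshold after
      \<open>t\<close>.\<close>
    then obtain b where "is_arg_min x (\<lambda>i. i \<in> {i \<in> B. t < x i + 1}) b"
      using ex_is_arg_min_if_finite [of "{i \<in> B. t < x i + 1}" x] by auto
    then have b: "b \<in> B" "t < x b + 1" "\<And>i. i \<in> B \<Longrightarrow> t < x i + 1 \<Longrightarrow> x b \<le> x i"
      by (auto simp: is_arg_min_linorder)
    show ?thesis
    proof (cases "\<exists>w\<in>N - B. card {i \<in> B. {i, w} \<in> E \<and> x i + 1 \<le> t} = d w")
      case True
      with less.prems show ?thesis by blast
    next
      case none: False
      \<comment> \<open>Passing that threshold adds at most \<open>b\<close> to a count, and every
        count was strictly below its demand.\<close>
      have "card {i \<in> B. {i, w} \<in> E \<and> x i + 1 \<le> x b + 1} \<le> d w" if w: "w \<in> N - B" for w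
      proof -
        have "i = b" if "i \<in> B" "x i + 1 \<le> x b + 1" "\<not> x i + 1 \<le> t" for i
        proof -
          have "x i = x b"
            using that b(3) [of i] by simp
          moreover have "inj_on x B"
            using st by blast
          ultimately show ?thesis
            using that(1) b(1) by (simp add: inj_on_eq_iff)
        qed
        then have "{i \<in> B. {i, w} \<in> E \<and> x i + 1 \<le> x b + 1}
            \<subseteq> insert b {i \<in> B. {i, w} \<in> E \<and> x i + 1 \<le> t}"
          by blast
        then have "card {i \<in> B. {i, w} \<in> E \<and> x i + 1 \<le> x b + 1}
            \<le> card (insert b {i \<in> B. {i, w} \<in> E \<and> x i + 1 \<le> t})"
          by (intro card_mono) auto
        also have "\<dots> \<le> Suc (card {i \<in> B. {i, w} \<in> E \<and> x i + 1 \<le> t})"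
          by (simp add: card_insert_if)
        also have "\<dots> \<le> d w"
        proof -
          have "card {i \<in> B. {i, w} \<in> E \<and> x i + 1 \<le> t} \<le> d w"
            using st w by blast
          moreover have "card {i \<in> B. {i, w} \<in> E \<and> x i + 1 \<le> t} \<noteq> d w"
            using none w by blast
          ultimately show ?thesis by simp
        qed
        finally show ?thesis .
      qed
      moreover have "x v \<le> x b + 1" if "v \<in> B" for v
        using st that b(2) by (meson less_eq_real_def order_trans)
      ultimately have "sweep_state E N d B x (x b + 1)"
        using st unfolding sweep_state_def by blast
      moreover have "card {i \<in> B. x b + 1 < x i + 1} < card {i \<in> B. t < x i + 1}"
        using b by (intro psubset_card_mono) auto
      ultimately show ?thesis
        using less.hyps by blast
    qed
  qed
qed

text \<open>The ready vertex \<open>w\<close> goes to a position just after \<open>t\<close>, before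
  the next threshold. It then sees exactly the neighbours counted at \<open>t\<close>, while the
  vertices in \<open>B\<close> lie too far left to receive an arc from it.\<close>

lemma sweep_extend:
  assumes "simple_graph E" and state: "sweep_state E N d B x t" and w: "w \<in> N - B"
    and dw: "card {i \<in> B. {i, w} \<in> E \<and> x i + 1 \<le> t} = d w"
  shows "\<exists>x' t'. sweep_state E N d (insert w B) x' t'"
proof -
  note st = state [unfolded sweep_state_def]
  \<comment> \<open>\<open>M\<close> is the distance to the next threshold, capped at 1; the
    inserted 1 keeps the set nonempty when no threshold is ahead. Halving \<open>M\<close> makes the
    inequalities strict.\<close>
  define M where "M = Min (insert 1 ((\<lambda>i. x i + 1 - t) ` {i \<in> B. t < x i + 1}))"
  define e where "e = M / 2"
  have M: "0 < M" "\<And>i. i \<in> B \<Longrightarrow> t < x i + 1 \<Longrightarrow> M \<le> x i + 1 - t"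
    unfolding M_def by auto
  then have e: "0 < e" "\<And>i. i \<in> B \<Longrightarrow> t < x i + 1 \<Longrightarrow> t + e < x i + 1"
    unfolding e_def by force+
  define x' where "x' = x(w := t + e)"
  have x'_B: "x' i = x i" if "i \<in> B" for i
    using that w by (auto simp: x'_def)
  have x'_w: "x' w = t + e"
    by (simp add: x'_def)
  have le: "x i \<le> t" if "i \<in> B" for i
    using st that by blast
  \<comment> \<open>No threshold lies after \<open>t\<close> and up to \<open>t + e\<close>, so the
    counts at both times agree and \<open>w\<close> does not land on a threshold.\<close>
  have iff: "x i + 1 \<le> t + e \<longleftrightarrow> x i + 1 \<le> t" "x i + 1 < t + e \<longleftrightarrow> x i + 1 \<le> t" "t + e \<noteq> x i + 1"
    if "i \<in> B" for i
    using e(1) e(2) [OF that] by linarith+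
  have noloop: "{w, w} \<notin> E"
    using edge_neq [OF assms(1)] by blast
  have "inj_on x' (insert w B)"
  proof -
    have "inj_on x' B"
      using st x'_B by (metis inj_on_cong)
    moreover have "x' w \<notin> x' ` (B - {w})"
      using x'_B x'_w le e(1) by force
    ultimately show ?thesis by simp
  qed
  moreover have "\<forall>v\<in>insert w B. x' v \<le> t + e"
    using x'_B x'_w le e(1) by force
  moreover have "card {i \<in> insert w B. {i, v} \<in> E \<and> x' i + 1 < x' v} = d v"
    if "v \<in> insert w B" for v
  proof (cases "v = w")
    case True
    then have "{i \<in> insert w B. {i, v} \<in> E \<and> x' i + 1 < x' v}
        = {i \<in> B. {i, w} \<in> E \<and> x i + 1 \<le> t}"
      using noloop x'_w x'_B iff(2) by auto
    with dw True show ?thesis by simp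
  next
    case False
    with that have v: "v \<in> B" by simp
    have "\<not> x' w + 1 < x' v"
      using le [OF v] x'_B [OF v] x'_w e(1) by linarith
    then have "{i \<in> insert w B. {i, v} \<in> E \<and> x' i + 1 < x' v}
        = {i \<in> B. {i, v} \<in> E \<and> x i + 1 < x v}"
      using x'_B v by auto
    with st v show ?thesis by simp
  qed
  moreover have "x' v \<noteq> x' i + 1"
    if "v \<in> insert w B" "i \<in> insert w B" "{i, v} \<in> E" for v i
  proof -
    have "x' w + 1 \<noteq> x' v" if "v \<in> B" for v
      using le [OF that] x'_B [OF that] x'_w e(1) by linarith
    moreover have "x' w \<noteq> x' i + 1" if "i \<in> B" for i
      using iff(3) [OF that] x'_B [OF that] x'_w by simp
    moreover have "x' v \<noteq> x' i + 1" if "v \<in> B" "i \<in> B" "{i, v} \<in> E" for i v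
      using that st x'_B by simp
    ultimately show ?thesis
      using that by (metis add_cancel_right_right insertE zero_neq_one)
  qed
  moreover have "card {i \<in> insert w B. {i, v} \<in> E \<and> x' i + 1 \<le> t + e} \<le> d v"
    if "v \<in> N - insert w B" for v
  proof -
    have "{i \<in> insert w B. {i, v} \<in> E \<and> x' i + 1 \<le> t + e}
        = {i \<in> B. {i, v} \<in> E \<and> x i + 1 \<le> t}"
      using x'_w x'_B iff(1) by auto
    with st that show ?thesis by simp
  qed
  ultimately have "sweep_state E N d (insert w B) x' (t + e)"
    using st w unfolding sweep_state_def by blast
  then show ?thesis by blast
qed

text \<open>Vertices are placed one at a time. Applied to the set of waiting vertices, the
  hypothesis on \<open>d\<close> supplies one with enough placed neighbours, so the sweep cannot get
  stuck.\<close>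

lemma sweep_realization:
  fixes d :: "'v::finite \<Rightarrow> nat"
  assumes "simple_graph E"
    and d: "\<And>Y. Y \<noteq> {} \<Longrightarrow> Y \<subseteq> N \<Longrightarrow> \<exists>v\<in>Y. d v \<le> card {i \<in> N - Y. {i, v} \<in> E}"
  obtains x :: "'v \<Rightarrow> real"
  where "\<forall>v\<in>N. card {i \<in> N. {i, v} \<in> E \<and> x i + 1 < x v} = d v"
    and "\<forall>v\<in>N. \<forall>i\<in>N. {i, v} \<in> E \<longrightarrow> x v \<noteq> x i + 1"
proof -
  have "\<exists>B x t. sweep_state E N d B x t \<and> card B = k" if "k \<le> card N" for k
    using that
  proof (induction k)
    case 0
    have "sweep_state E N d {} (\<lambda>_. 0) 0"
      by (simp add: sweep_state_def)
    then show ?case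
      using card.empty by blast
  next
    case (Suc k)
    then obtain B x t where B: "sweep_state E N d B x t" "card B = k" by auto
    then have "B \<subseteq> N" by (simp add: sweep_state_def)
    with B(2) Suc.prems have "N - B \<noteq> {}" by auto
    from d [OF this Diff_subset] obtain v
      where "v \<in> N - B" "d v \<le> card {i \<in> N - (N - B). {i, v} \<in> E}" ..
    moreover have "N - (N - B) = B" using \<open>B \<subseteq> N\<close> by blast
    ultimately have "v \<in> N - B" "d v \<le> card {i \<in> B. {i, v} \<in> E}" by simp_all
    from sweep_advance [OF B(1) this] obtain t' w where "sweep_state E N d B x t'" and w: "w \<in> N - B"
      and "card {i \<in> B. {i, w} \<in> E \<and> x i + 1 \<le> t'} = d w"
      by blast
    from sweep_extend [OF assms(1) this] obtain x' t''
      where "sweep_state E N d (insert w B) x' t''"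
      by blast
    moreover have "card (insert w B) = Suc k" using w B(2) by simp
    ultimately show ?case by blast
  qed
  then obtain B x t where B: "sweep_state E N d B x t" "card B = card N" by blast
  then have "B = N" by (simp add: sweep_state_def card_subset_eq)
  with B(1) that [of x] show thesis
    unfolding sweep_state_def by blast
qed

section \<open>Regions as cells\<close>

definition nonsink_pairs :: "'v set set \<Rightarrow> 'v \<Rightarrow> ('v \<times> 'v) set" where
  "nonsink_pairs E q = {(i, j). i \<noteq> q \<and> j \<noteq> q \<and> i \<noteq> j \<and> {i, j} \<in> E}"

definition wall :: "'v::finite \<times> 'v \<Rightarrow> real ^ 'v" where
  "wall p = axis (snd p) 1 - axis (fst p) 1"

lemma inner_wall: "wall p \<bullet> x = x $ snd p - x $ fst p"
  by (simp add: wall_def inner_diff_left inner_axis')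

lemma wall_eq_iff:
  assumes "fst p \<noteq> snd p" "fst p' \<noteq> snd p'"
  shows "wall p = wall p' \<longleftrightarrow> p = p'"
proof
  assume eq: "wall p = wall p'"
  then have "wall p $ snd p = wall p' $ snd p" "wall p $ fst p = wall p' $ fst p"
    by simp_all
  with assms show "p = p'"
    by (auto simp: wall_def axis_def prod_eq_iff split: if_splits)
qed simp

definition arcs :: "'v::finite set set \<Rightarrow> 'v \<Rightarrow> real ^ 'v \<Rightarrow> ('v \<times> 'v) set" where
  "arcs E q x = {p \<in> nonsink_pairs E q. 1 < wall p \<bullet> x}"

definition wall_complement :: "'v::finite set set \<Rightarrow> 'v \<Rightarrow> (real ^ 'v) set" where
  "wall_complement E q = {x \<in> nonsink_space q. \<forall>p\<in>nonsink_pairs E q. wall p \<bullet> x \<noteq> 1}"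

text \<open>The sink coordinate is left free so that the set is open in the whole space
  \<open>real ^ 'v\<close>. The set \<open>P\<close> is a parameter because a single wall is dropped
  from it later.\<close>

definition open_cell :: "('v::finite \<times> 'v) set \<Rightarrow> ('v \<times> 'v) set \<Rightarrow> (real ^ 'v) set" where
  "open_cell P A = (\<Inter>p\<in>P. if p \<in> A then {x. wall p \<bullet> x > 1} else {x. wall p \<bullet> x < 1})"

definition cell :: "'v::finite set set \<Rightarrow> 'v \<Rightarrow> ('v \<times> 'v) set \<Rightarrow> (real ^ 'v) set" where
  "cell E q A = nonsink_space q \<inter> open_cell (nonsink_pairs E q) A"

lemma mem_open_cell_iff:
  "x \<in> open_cell P A \<longleftrightarrow> (\<forall>p\<in>P. if p \<in> A then 1 < wall p \<bullet> x else wall p \<bullet> x < 1)"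
  by (auto simp: open_cell_def)

lemma wall_complement_eq:
  "nonsink_space q - \<Union>(semiorder_arrangement E q) = wall_complement E q"
proof -
  have "x \<in> \<Union>(semiorder_arrangement E q) \<longleftrightarrow> (\<exists>p\<in>nonsink_pairs E q. wall p \<bullet> x = 1)"
    if "x \<in> nonsink_space q" for x
  proof
    assume "x \<in> \<Union>(semiorder_arrangement E q)"
    then obtain i j where ij: "i \<noteq> q" "j \<noteq> q" "i \<noteq> j" "{i, j} \<in> E" "x $ i - x $ j = 1"
      by (auto simp: semiorder_arrangement_def)
    then have "(j, i) \<in> nonsink_pairs E q"
      by (simp add: nonsink_pairs_def insert_commute)
    with ij(5) show "\<exists>p\<in>nonsink_pairs E q. wall p \<bullet> x = 1"
      by (intro bexI [of _ "(j, i)"]) (simp_all add: inner_wall)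
  next
    assume "\<exists>p\<in>nonsink_pairs E q. wall p \<bullet> x = 1"
    then obtain i j where ij: "(i, j) \<in> nonsink_pairs E q" "x $ j - x $ i = 1"
      by (auto simp: inner_wall)
    then have "j \<noteq> q" "i \<noteq> q" "j \<noteq> i" "{j, i} \<in> E"
      by (auto simp: nonsink_pairs_def insert_commute)
    then have "{x \<in> nonsink_space q. x $ j - x $ i = 1} \<in> semiorder_arrangement E q"
      unfolding semiorder_arrangement_def by blast
    with that ij(2) show "x \<in> \<Union>(semiorder_arrangement E q)"
      by blast
  qed
  then show ?thesis
    by (auto simp: wall_complement_def)
qed

section \<open>Cells as connected components\<close>

lemma open_open_cell: "open (open_cell P A)" for P :: "('v::finite \<times> 'v) set"
  unfolding open_cell_def by (auto intro!: open_INT open_halfspace_gt open_halfspace_lt)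

lemma subspace_nonsink_space: "subspace (nonsink_space q)"
  by (simp add: nonsink_space_def subspace_def)

lemma convex_cell: "convex (cell E q A)"
  unfolding cell_def open_cell_def
  by (intro convex_Int convex_INT subspace_imp_convex [OF subspace_nonsink_space])
    (simp add: convex_halfspace_gt convex_halfspace_lt)

lemma mem_cell_iff:
  assumes "A \<subseteq> nonsink_pairs E q"
  shows "x \<in> cell E q A \<longleftrightarrow> x \<in> wall_complement E q \<and> arcs E q x = A"
proof -
  have "x \<in> open_cell (nonsink_pairs E q) A \<longleftrightarrow>
      (\<forall>p\<in>nonsink_pairs E q. if p \<in> A then 1 < wall p \<bullet> x else wall p \<bullet> x < 1)"
    by (rule mem_open_cell_iff)
  also have "\<dots> \<longleftrightarrow>
      (\<forall>p\<in>nonsink_pairs E q. wall p \<bullet> x \<noteq> 1 \<and> (1 < wall p \<bullet> x \<longleftrightarrow> p \<in> A))"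
    by (intro ball_cong refl) (simp, linarith)
  also have "\<dots> \<longleftrightarrow> (\<forall>p\<in>nonsink_pairs E q. wall p \<bullet> x \<noteq> 1) \<and> arcs E q x = A"
    using assms unfolding arcs_def by blast
  finally show ?thesis
    by (auto simp: cell_def wall_complement_def)
qed

lemma arcs_subset: "arcs E q x \<subseteq> nonsink_pairs E q"
  by (auto simp: arcs_def)

text \<open>By the intermediate value property, a connected set with points on both sides of a wall
  would meet that wall.\<close>

lemma arcs_eq_if_connected:
  assumes "connected C" "C \<subseteq> wall_complement E q" "x \<in> C" "y \<in> C"
  shows "arcs E q x = arcs E q y"
proof -
  have "1 < wall p \<bullet> v" if uv: "u \<in> C" "v \<in> C" "p \<in> nonsink_pairs E q" "1 < wall p \<bullet> u" for u v p
  proof (rule ccontr)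
    assume "\<not> 1 < wall p \<bullet> v"
    then obtain z where "z \<in> C" "wall p \<bullet> z = 1"
      using connected_ivt_hyperplane [OF assms(1) uv(2,1), of "wall p" 1] uv(4) by auto
    with assms(2) uv(3) show False by (auto simp: wall_complement_def)
  qed
  with assms(3,4) show ?thesis unfolding arcs_def by blast
qed

text \<open>Cells are convex, hence connected, and no connected set off the walls leaves a cell.
  Allowing \<open>S\<close> to be any union of cells makes the result serve both for all regions and
  for the admissible ones.\<close>

lemma components_eq_cells:
  assumes S: "S \<subseteq> wall_complement E q" and sat: "\<And>x. x \<in> S \<Longrightarrow> cell E q (arcs E q x) \<subseteq> S"
  shows "components S = (\<lambda>x. cell E q (arcs E q x)) ` S"
proof -
  have "connected_component_set S x = cell E q (arcs E q x)" if x: "x \<in> S" for x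
  proof
    show "connected_component_set S x \<subseteq> cell E q (arcs E q x)"
    proof
      fix y assume "y \<in> connected_component_set S x"
      then obtain T where "connected T" "T \<subseteq> S" "x \<in> T" "y \<in> T"
        by (auto simp: connected_component_def)
      with S have "y \<in> wall_complement E q" "arcs E q y = arcs E q x"
        using arcs_eq_if_connected [of T E q y x] by auto
      then show "y \<in> cell E q (arcs E q x)"
        by (simp add: mem_cell_iff [OF arcs_subset])
    qed
    have "x \<in> cell E q (arcs E q x)"
      using x S by (auto simp: mem_cell_iff [OF arcs_subset])
    then show "cell E q (arcs E q x) \<subseteq> connected_component_set S x"
      by (intro connected_component_maximal convex_connected convex_cell sat x)
  qed
  then show ?thesis
    unfolding components_def by (rule image_cong [OF refl])
qed

lemma regions_eq: "regions E q = (\<lambda>x. cell E q (arcs E q x)) ` wall_complement E q"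
  unfolding regions_def wall_complement_eq
  by (rule components_eq_cells) (auto simp: mem_cell_iff [OF arcs_subset])

section \<open>The arc set of a region\<close>

definition region_arcs ::
    "'v::finite set set \<Rightarrow> 'v \<Rightarrow> (real ^ 'v) set \<Rightarrow> ('v \<times> 'v) set" where
  "region_arcs E q r = {p \<in> nonsink_pairs E q. \<forall>x\<in>r. 1 < wall p \<bullet> x}"

lemma region_arcs_subset: "region_arcs E q r \<subseteq> nonsink_pairs E q"
  by (auto simp: region_arcs_def)

lemma region_arcs_cell:
  assumes "A \<subseteq> nonsink_pairs E q" "cell E q A \<noteq> {}"
  shows "region_arcs E q (cell E q A) = A"
proof -
  obtain x where "x \<in> cell E q A" using assms(2) by blast
  moreover have "arcs E q x = A" if "x \<in> cell E q A" for x
    using that mem_cell_iff [OF assms(1)] by blast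
  ultimately show ?thesis
    unfolding region_arcs_def arcs_def by blast
qed

lemma regions_iff:
  "r \<in> regions E q \<longleftrightarrow> r = cell E q (region_arcs E q r) \<and> r \<noteq> {}"
proof
  assume "r \<in> regions E q"
  then obtain x where x: "x \<in> wall_complement E q" "r = cell E q (arcs E q x)"
    by (auto simp: regions_eq)
  then have "x \<in> r" by (simp add: mem_cell_iff [OF arcs_subset])
  then show "r = cell E q (region_arcs E q r) \<and> r \<noteq> {}"
    using region_arcs_cell [OF arcs_subset] x(2) by (metis empty_iff)
next
  assume r: "r = cell E q (region_arcs E q r) \<and> r \<noteq> {}"
  then obtain x where "x \<in> cell E q (region_arcs E q r)" by auto
  then have "x \<in> wall_complement E q" "arcs E q x = region_arcs E q r"
    by (simp_all add: mem_cell_iff [OF region_arcs_subset])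
  with r show "r \<in> regions E q"
    unfolding regions_eq by (metis imageI)
qed

lemma cell_in_regions:
  assumes "A \<subseteq> nonsink_pairs E q" "cell E q A \<noteq> {}"
  shows "cell E q A \<in> regions E q"
  using assms by (simp add: regions_iff region_arcs_cell)

lemma arcs_eq_region_arcs:
  assumes "r \<in> regions E q" "x \<in> r"
  shows "x \<in> wall_complement E q" "arcs E q x = region_arcs E q r"
proof -
  have "x \<in> cell E q (region_arcs E q r)"
    using assms by (simp add: regions_iff)
  then show "x \<in> wall_complement E q" "arcs E q x = region_arcs E q r"
    by (simp_all add: mem_cell_iff [OF region_arcs_subset])
qed

lemma regions_eqI:
  assumes "r \<in> regions E q" "r' \<in> regions E q" "region_arcs E q r = region_arcs E q r'"
  shows "r = r'"
proof -
  have "r = cell E q (region_arcs E q r)" "r' = cell E q (region_arcs E q r')"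
    using assms(1,2) by (simp_all add: regions_iff)
  with assms(3) show ?thesis by simp
qed

lemma finite_regions: "finite (regions E q)"
proof (rule finite_subset)
  show "regions E q \<subseteq> range (cell E q)"
    by (auto simp: regions_eq)
qed simp

lemma central_region_eq: "central_region E q = cell E q {}"
proof -
  have "(\<forall>i j. i \<noteq> q \<and> j \<noteq> q \<and> i \<noteq> j \<and> {i, j} \<in> E \<longrightarrow> \<bar>x $ i - x $ j\<bar> < 1) \<longleftrightarrow>
        (\<forall>p\<in>nonsink_pairs E q. wall p \<bullet> x < 1)" (is "?L \<longleftrightarrow> ?R") for x
  proof
    show ?R if L: ?L
    proof
      fix p assume "p \<in> nonsink_pairs E q"
      then have "\<bar>x $ fst p - x $ snd p\<bar> < 1"
        using L by (auto simp: nonsink_pairs_def)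
      then show "wall p \<bullet> x < 1"
        unfolding inner_wall by linarith
    qed
    show ?L if R: ?R
    proof (intro allI impI)
      fix i j assume "i \<noteq> q \<and> j \<noteq> q \<and> i \<noteq> j \<and> {i, j} \<in> E"
      then have "(i, j) \<in> nonsink_pairs E q" "(j, i) \<in> nonsink_pairs E q"
        by (auto simp: nonsink_pairs_def insert_commute)
      with R have "wall (i, j) \<bullet> x < 1" "wall (j, i) \<bullet> x < 1"
        by blast+
      then show "\<bar>x $ i - x $ j\<bar> < 1"
        by (simp add: inner_wall abs_less_iff)
    qed
  qed
  then show ?thesis
    by (auto simp: central_region_def cell_def open_cell_def)
qed

lemma central_region:
  "central_region E q \<in> regions E q" "region_arcs E q (central_region E q) = {}"
proof -
  have "0 \<in> cell E q {}"
    by (simp add: cell_def open_cell_def nonsink_space_def)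
  then have "cell E q {} \<noteq> {}" by blast
  then show "central_region E q \<in> regions E q" "region_arcs E q (central_region E q) = {}"
    unfolding central_region_eq by (simp_all add: cell_in_regions region_arcs_cell)
qed

section \<open>Bordering regions\<close>

lemma closure_halfspace:
  assumes "x \<in> closure r"
  shows "(\<And>y. y \<in> r \<Longrightarrow> a \<bullet> y \<le> b) \<Longrightarrow> a \<bullet> x \<le> b"
    and "(\<And>y. y \<in> r \<Longrightarrow> b \<le> a \<bullet> y) \<Longrightarrow> b \<le> a \<bullet> x"
proof -
  show "a \<bullet> x \<le> b" if "\<And>y. y \<in> r \<Longrightarrow> a \<bullet> y \<le> b"
    using closure_minimal [of r "{y. a \<bullet> y \<le> b}"] that assms closed_halfspace_le by blast
  show "b \<le> a \<bullet> x" if "\<And>y. y \<in> r \<Longrightarrow> b \<le> a \<bullet> y"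
    using closure_minimal [of r "{y. a \<bullet> y \<ge> b}"] that assms closed_halfspace_ge by blast
qed

lemma closure_region_subset:
  assumes "r \<in> regions E q"
  shows "closure r \<subseteq> nonsink_space q"
proof (rule closure_minimal)
  show "r \<subseteq> nonsink_space q"
    using assms by (auto simp: regions_iff cell_def)
qed (rule closed_subspace [OF subspace_nonsink_space])

lemma aff_dim_wall:
  assumes "fst p \<noteq> q" "snd p \<noteq> q" "fst p \<noteq> snd p"
  shows "aff_dim (nonsink_space q \<inter> {x. wall p \<bullet> x = 1}) = aff_dim (nonsink_space q) - 1"
    and "affine (nonsink_space q \<inter> {x. wall p \<bullet> x = 1})"
    and "nonsink_space q \<inter> {x. wall p \<bullet> x = 1} \<noteq> {}"
proof -
  have aff: "affine (nonsink_space q)"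
    using subspace_nonsink_space by (rule subspace_imp_affine)
  have "axis (snd p) 1 \<in> nonsink_space q \<inter> {x. wall p \<bullet> x = 1}"
    using assms by (simp add: nonsink_space_def inner_wall axis_def)
  then show ne: "nonsink_space q \<inter> {x. wall p \<bullet> x = 1} \<noteq> {}"
    by blast
  \<comment> \<open>The origin lies in the space but off the wall, so the wall cuts the space
    properly and lowers the dimension by one.\<close>
  have "0 \<in> nonsink_space q" "0 \<notin> {x. wall p \<bullet> x = 1}"
    by (simp_all add: nonsink_space_def)
  then have "\<not> nonsink_space q \<subseteq> {x. wall p \<bullet> x = 1}"
    by blast
  with ne show "aff_dim (nonsink_space q \<inter> {x. wall p \<bullet> x = 1}) = aff_dim (nonsink_space q) - 1"
    by (simp add: aff_dim_affine_Int_hyperplane [OF aff])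
  show "affine (nonsink_space q \<inter> {x. wall p \<bullet> x = 1})"
    by (intro affine_Int aff affine_hyperplane)
qed

text \<open>Two different walls intersect in a set of smaller dimension than either, so the
  intersection cannot contain \<open>F\<close>, which has the dimension of a wall.\<close>

lemma facet_wall_unique:
  assumes F: "aff_dim F = aff_dim (nonsink_space q) - 1"
    and p: "fst p \<noteq> q" "snd p \<noteq> q" "fst p \<noteq> snd p"
    and p': "fst p' \<noteq> q" "snd p' \<noteq> q" "fst p' \<noteq> snd p'"
    and sub: "\<And>x. x \<in> F \<Longrightarrow> x \<in> nonsink_space q \<and> wall p \<bullet> x = 1 \<and> wall p' \<bullet> x = 1"
  shows "p = p'"
proof (rule ccontr)
  assume "p \<noteq> p'"
  define H where "H = nonsink_space q \<inter> {x. wall p \<bullet> x = 1}"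
  note H = aff_dim_wall [OF p, folded H_def]
  have "\<not> H \<subseteq> {x. wall p' \<bullet> x = 1}"
  proof
    assume H': "H \<subseteq> {x. wall p' \<bullet> x = 1}"
    \<comment> \<open>These two points of \<open>H\<close> pin down a pair: the first lies on the
      wall of \<open>p'\<close> only if \<open>snd p' = snd p\<close>, the second only if
      \<open>fst p' = fst p\<close>.\<close>
    have "axis (snd p) 1 \<in> H" "- axis (fst p) 1 \<in> H"
      using p by (simp_all add: H_def nonsink_space_def inner_wall axis_def)
    with H' have "wall p' \<bullet> axis (snd p) 1 = 1" "wall p' \<bullet> (- axis (fst p) 1) = 1"
      by blast+
    with p p' \<open>p \<noteq> p'\<close> show False
      by (auto simp: inner_wall axis_def prod_eq_iff split: if_splits)
  qed
  then have "aff_dim (H \<inter> {x. wall p' \<bullet> x = 1}) < aff_dim H"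
    using aff_dim_affine_Int_hyperplane [OF H(2), of "wall p'" 1] H(3) aff_dim_geq [of H] aff_dim_empty [of H]
    by (auto split: if_splits)
  moreover have "aff_dim F \<le> aff_dim (H \<inter> {x. wall p' \<bullet> x = 1})"
    using sub by (intro aff_dim_subset) (auto simp: H_def)
  ultimately show False
    using F H(1) by simp
qed

lemma sym_diff_eq_singleton:
  assumes "(A - B) \<union> (B - A) = {p}"
  shows "p \<notin> A \<and> B = insert p A \<or> p \<notin> B \<and> A = insert p B"
proof -
  have diff: "(v \<in> A \<longleftrightarrow> v \<in> B) \<longleftrightarrow> v \<noteq> p" for v
    using assms by (auto simp: set_eq_iff)
  show ?thesis
  proof (cases "p \<in> A")
    case True
    have "v \<in> A \<longleftrightarrow> v \<in> insert p B" for v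
      using diff [of v] True by (cases "v = p") simp_all
    with True diff [of p] show ?thesis by blast
  next
    case False
    have "v \<in> B \<longleftrightarrow> v \<in> insert p A" for v
      using diff [of v] diff [of p] False by (cases "v = p") simp_all
    with False show ?thesis by blast
  qed
qed

text \<open>A wall that separates the regions contains the intersection of their closures. As this
  intersection has the dimension of a wall, at most one pair can separate them, and since the
  regions are distinct, one does.\<close>

lemma bordering_region_arcs:
  assumes r: "r \<in> regions E q" and r': "r' \<in> regions E q" and b: "bordering q r r'"
  shows "\<exists>p. p \<notin> region_arcs E q r \<and> region_arcs E q r' = insert p (region_arcs E q r) \<or>
             p \<notin> region_arcs E q r' \<and> region_arcs E q r = insert p (region_arcs E q r')"
proof -
  let ?A = "region_arcs E q r" and ?A' = "region_arcs E q r'"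
  have on_wall: "wall p \<bullet> x = 1"
    if s: "s \<in> regions E q" "s' \<in> regions E q" "x \<in> closure s \<inter> closure s'"
      and p: "p \<in> region_arcs E q s" "p \<notin> region_arcs E q s'" for p x s s'
  proof (rule antisym)
    have "1 \<le> wall p \<bullet> y" if "y \<in> s" for y
      using that p(1) by (force simp: region_arcs_def)
    moreover have "x \<in> closure s" using s(3) by blast
    ultimately show "1 \<le> wall p \<bullet> x"
      by (metis closure_halfspace(2))
    have "wall p \<bullet> y \<le> 1" if "y \<in> s'" for y
    proof -
      have "p \<notin> arcs E q y"
        using p(2) arcs_eq_region_arcs(2) [OF s(2) that] by simp
      moreover have "p \<in> nonsink_pairs E q"
        using p(1) region_arcs_subset by blast
      ultimately show ?thesis
        by (simp add: arcs_def not_less)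
    qed
    moreover have "x \<in> closure s'" using s(3) by blast
    ultimately show "wall p \<bullet> x \<le> 1"
      by (metis closure_halfspace(1))
  qed
  have unique: "p = p'" if pp: "p \<in> (?A - ?A') \<union> (?A' - ?A)" "p' \<in> (?A - ?A') \<union> (?A' - ?A)" for p p'
  proof (rule facet_wall_unique)
    show "aff_dim (closure r \<inter> closure r') = aff_dim (nonsink_space q) - 1"
      using b by (simp add: bordering_def)
    have "p \<in> nonsink_pairs E q" "p' \<in> nonsink_pairs E q"
      using pp region_arcs_subset by blast+
    then show "fst p \<noteq> q" "snd p \<noteq> q" "fst p \<noteq> snd p"
      "fst p' \<noteq> q" "snd p' \<noteq> q" "fst p' \<noteq> snd p'"
      by (auto simp: nonsink_pairs_def)
    show "x \<in> nonsink_space q \<and> wall p \<bullet> x = 1 \<and> wall p' \<bullet> x = 1"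
      if x: "x \<in> closure r \<inter> closure r'" for x
    proof -
      have "wall s \<bullet> x = 1" if "s \<in> (?A - ?A') \<union> (?A' - ?A)" for s
        using that x on_wall [OF r r', of x s] on_wall [OF r' r, of x s] by blast
      moreover have "x \<in> nonsink_space q"
        using x closure_region_subset [OF r] by blast
      ultimately show ?thesis
        using pp by blast
    qed
  qed
  have "?A \<noteq> ?A'"
    using regions_eqI [OF r r'] b by (auto simp: bordering_def)
  then obtain p where "p \<in> (?A - ?A') \<union> (?A' - ?A)" by blast
  with unique have "(?A - ?A') \<union> (?A' - ?A) = {p}" by blast
  from sym_diff_eq_singleton [OF this] show ?thesis by (rule exI)
qed

text \<open>\<open>crossing_pair\<close> is a definite description. Existence needs that the reverse
  of \<open>p\<close> is not an arc of \<open>r\<close> either; uniqueness holds because the wall of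
  any pair with the required property contains the intersection of the closures.\<close>

lemma crossing_pair_eq:
  assumes r: "r \<in> regions E q" and r': "r' \<in> regions E q" and b: "bordering q r r'"
    and p: "p \<notin> region_arcs E q r" "region_arcs E q r' = insert p (region_arcs E q r)"
  shows "crossing_pair q r r' = p"
proof -
  obtain i j where ij: "p = (i, j)" by (cases p)
  have pair: "(i, j) \<in> nonsink_pairs E q" "(j, i) \<in> nonsink_pairs E q"
    using p(2) region_arcs_subset [of E q r'] ij by (auto simp: nonsink_pairs_def insert_commute)
  have r'_gt: "x $ j > x $ i + 1" if "x \<in> r'" for x
    using p(2) that by (force simp: region_arcs_def ij inner_wall)
  \<comment> \<open>Both directions of one edge cannot be arcs at the same point, so the reverse
    pair is missing in \<open>r'\<close> and hence in \<open>r\<close>.\<close>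
  obtain y where "y \<in> r'" using r' by (auto simp: regions_iff)
  from r'_gt [OF this] this have "(j, i) \<notin> region_arcs E q r'"
    by (force simp: region_arcs_def inner_wall)
  with p(2) have ji: "(j, i) \<notin> region_arcs E q r" by blast
  have r_lt: "\<bar>x $ i - x $ j\<bar> < 1" if "x \<in> r" for x
  proof -
    have "(i, j) \<notin> arcs E q x" "(j, i) \<notin> arcs E q x"
      using arcs_eq_region_arcs(2) [OF r that] p(1) ji ij by simp_all
    moreover have "wall (i, j) \<bullet> x \<noteq> 1" "wall (j, i) \<bullet> x \<noteq> 1"
      using arcs_eq_region_arcs(1) [OF r that] pair by (auto simp: wall_complement_def)
    ultimately show ?thesis
      using pair by (auto simp: arcs_def inner_wall)
  qed
  have wall_le: "1 \<le> wall s \<bullet> x \<and> wall s \<bullet> x \<le> 1"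
    if "\<forall>x\<in>r. \<bar>x $ fst s - x $ snd s\<bar> < 1" "\<forall>x\<in>r'. x $ snd s > x $ fst s + 1"
      "x \<in> closure r \<inter> closure r'" for s x
    using that by (intro conjI closure_halfspace(1) [of x r] closure_halfspace(2) [of x r'])
      (force simp: inner_wall)+
  show ?thesis
    unfolding crossing_pair_def ij
  proof (rule the_equality)
    show "case (i, j) of (i, j) \<Rightarrow> i \<noteq> q \<and> j \<noteq> q \<and> i \<noteq> j \<and>
        (\<forall>x\<in>r. \<bar>x $ i - x $ j\<bar> < 1) \<and> (\<forall>x\<in>r'. x $ j > x $ i + 1)"
      using pair r_lt r'_gt by (auto simp: nonsink_pairs_def)
    fix s
    assume s: "case s of (i, j) \<Rightarrow> i \<noteq> q \<and> j \<noteq> q \<and> i \<noteq> j \<and>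
        (\<forall>x\<in>r. \<bar>x $ i - x $ j\<bar> < 1) \<and> (\<forall>x\<in>r'. x $ j > x $ i + 1)"
    show "s = (i, j)"
    proof (rule facet_wall_unique)
      show "aff_dim (closure r \<inter> closure r') = aff_dim (nonsink_space q) - 1"
        using b by (simp add: bordering_def)
      show "fst s \<noteq> q" "snd s \<noteq> q" "fst s \<noteq> snd s"
        using s by (auto simp: case_prod_beta)
      show "fst (i, j) \<noteq> q" "snd (i, j) \<noteq> q" "fst (i, j) \<noteq> snd (i, j)"
        using pair by (auto simp: nonsink_pairs_def)
      fix x assume x: "x \<in> closure r \<inter> closure r'"
      then have "x \<in> nonsink_space q"
        using closure_region_subset [OF r] by blast
      moreover have "1 \<le> wall s \<bullet> x \<and> wall s \<bullet> x \<le> 1"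
        using s x by (intro wall_le) (auto simp: case_prod_beta)
      moreover have "1 \<le> wall (i, j) \<bullet> x \<and> wall (i, j) \<bullet> x \<le> 1"
        using r_lt r'_gt x by (intro wall_le) auto
      ultimately show "x \<in> nonsink_space q \<and> wall s \<bullet> x = 1 \<and> wall (i, j) \<bullet> x = 1"
        by auto
    qed
  qed
qed

text \<open>The points where two walls take the same value form finitely many hyperplanes, a null
  set that cannot cover a nonempty open cell.\<close>

lemma generic_point:
  assumes "r \<in> regions E q"
  obtains x where "x \<in> r" "inj_on (\<lambda>p. wall p \<bullet> x) (nonsink_pairs E q)"
proof -
  let ?P = "nonsink_pairs E q" and ?A = "region_arcs E q r"
  define T where "T = {(p, p'). p \<in> ?P \<and> p' \<in> ?P \<and> p \<noteq> p'}"
  have "negligible {x. (wall p - wall p') \<bullet> x = 0}" if "(p, p') \<in> T" for p p'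
  proof (rule negligible_hyperplane)
    have "wall p \<noteq> wall p'"
      using that by (subst wall_eq_iff) (auto simp: T_def nonsink_pairs_def)
    then show "wall p - wall p' \<noteq> 0 \<or> 0 \<noteq> (0::real)" by simp
  qed
  then have "negligible (\<Union>(p, p')\<in>T. {x. (wall p - wall p') \<bullet> x = 0})"
    by (intro negligible_Union) auto
  moreover have "\<not> negligible (open_cell ?P ?A)"
    using assms by (intro open_not_negligible open_open_cell) (auto simp: regions_iff cell_def)
  ultimately obtain y where y: "y \<in> open_cell ?P ?A"
    and y_generic: "y \<notin> (\<Union>(p, p')\<in>T. {x. (wall p - wall p') \<bullet> x = 0})"
    using negligible_subset by blast
  \<comment> \<open>The measure argument takes place in the whole space; resetting the sink
    coordinate changes no value of a wall in \<open>?P\<close> and returns to the coordinate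
    subspace.\<close>
  define x where "x = (\<chi> v. if v = q then 0 else y $ v)"
  have wall_x: "wall p \<bullet> x = wall p \<bullet> y" if "p \<in> ?P" for p
    using that by (auto simp: inner_wall x_def nonsink_pairs_def)
  have "x \<in> nonsink_space q"
    by (simp add: nonsink_space_def x_def)
  moreover have "x \<in> open_cell ?P ?A"
    using y wall_x by (auto simp: mem_open_cell_iff split: if_splits)
  ultimately have "x \<in> r"
    using assms by (metis IntI cell_def regions_iff)
  moreover have "inj_on (\<lambda>p. wall p \<bullet> x) ?P"
    using y_generic by (auto simp: inj_on_def wall_x T_def inner_diff_left)
  ultimately show thesis ..
qed

text \<open>
  Shrinking a generic point of \<open>r\<close> towards the origin crosses the walls one at a time; the first
  crossing exhibits a region bordering \<open>r\<close> that is closer to the central region.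
\<close>

lemma lower_bordering_region:
  assumes r: "r \<in> regions E q" and ne: "region_arcs E q r \<noteq> {}"
  obtains r' p where "r' \<in> regions E q" "bordering q r' r"
    "p \<notin> region_arcs E q r'" "region_arcs E q r = insert p (region_arcs E q r')"
proof -
  let ?P = "nonsink_pairs E q" and ?A = "region_arcs E q r"
  obtain x where x: "x \<in> r" and inj: "inj_on (\<lambda>p. wall p \<bullet> x) ?P"
    using generic_point [OF r] .
  have r_eq: "r = cell E q ?A" using r by (simp add: regions_iff)
  have x_sub: "x \<in> nonsink_space q" and x_cell: "x \<in> open_cell ?P ?A"
    using x r_eq by (auto simp: cell_def)
  \<comment> \<open>Scaling \<open>x\<close> by \<open>1 / m\<close> brings \<open>p0\<close>, the
    arc with the smallest value, to its wall; genericity keeps all other arcs strictly above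
    theirs.\<close>
  obtain p0 where "is_arg_min (\<lambda>p. wall p \<bullet> x) (\<lambda>p. p \<in> ?A) p0"
    using ex_is_arg_min_if_finite [of ?A "\<lambda>p. wall p \<bullet> x"] ne by auto
  then have p0: "p0 \<in> ?A" "\<And>p. p \<in> ?A \<Longrightarrow> wall p0 \<bullet> x \<le> wall p \<bullet> x"
    by (auto simp: is_arg_min_linorder)
  have p0_P: "p0 \<in> ?P" using p0(1) region_arcs_subset by blast
  define m where "m = wall p0 \<bullet> x"
  have m: "1 < m" using p0(1) x by (simp add: m_def region_arcs_def)
  have gt_m: "m < wall p \<bullet> x" if "p \<in> ?A - {p0}" for p
  proof -
    have "p \<in> ?P" using that region_arcs_subset by blast
    then have "wall p \<bullet> x \<noteq> m"
      using inj that p0_P unfolding m_def by (metis (mono_tags, lifting) DiffD2 inj_onD singletonI)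
    with p0(2) [of p] that show ?thesis by (simp add: m_def)
  qed
  \<comment> \<open>Within \<open>W\<close> every wall but that of \<open>p0\<close> is on the same
    side as for \<open>r\<close>, so on the coordinate subspace the side of this one wall decides
    between \<open>r\<close> and the cell of \<open>A'\<close>.\<close>
  define W where "W = open_cell (?P - {p0}) ?A"
  have open_W: "open W" by (simp add: W_def open_open_cell)
  define z where "z = (1 / m) *\<^sub>R x"
  have z_wall: "wall p0 \<bullet> z = 1" using m by (simp add: z_def m_def)
  have z_sub: "z \<in> nonsink_space q"
    using x_sub by (simp add: z_def nonsink_space_def)
  have "z \<in> W"
  proof -
    have "wall p \<bullet> z < 1" if "p \<in> ?P" "p \<notin> ?A" for p
    proof -
      have "wall p \<bullet> x < m" using x_cell that m by (force simp: mem_open_cell_iff)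
      then show ?thesis using m by (simp add: z_def)
    qed
    moreover have "1 < wall p \<bullet> z" if "p \<in> ?A - {p0}" for p
      using gt_m [OF that] m by (simp add: z_def)
    ultimately show ?thesis by (auto simp: W_def mem_open_cell_iff)
  qed
  define A' where "A' = ?A - {p0}"
  have A': "A' \<subseteq> ?P" using region_arcs_subset by (auto simp: A'_def)
  have above: "y \<in> r" if "y \<in> nonsink_space q" "y \<in> W" "1 < wall p0 \<bullet> y" for y
  proof -
    have "y \<in> open_cell ?P ?A"
      unfolding mem_open_cell_iff
    proof
      fix p assume "p \<in> ?P"
      then show "if p \<in> ?A then 1 < wall p \<bullet> y else wall p \<bullet> y < 1"
        using that(2,3) p0(1) by (cases "p = p0") (simp_all add: mem_open_cell_iff W_def)
    qed
    with that(1) show ?thesis by (subst r_eq) (simp add: cell_def)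
  qed
  have below: "y \<in> cell E q A'" if "y \<in> nonsink_space q" "y \<in> W" "wall p0 \<bullet> y < 1" for y
  proof -
    have "y \<in> open_cell ?P A'"
      unfolding mem_open_cell_iff
    proof
      fix p assume "p \<in> ?P"
      then show "if p \<in> A' then 1 < wall p \<bullet> y else wall p \<bullet> y < 1"
        using that(2,3) by (cases "p = p0") (simp_all add: mem_open_cell_iff W_def A'_def)
    qed
    with that(1) show ?thesis by (simp add: cell_def)
  qed
  \<comment> \<open>Scaling a point of the wall by \<open>1 + e\<close> or \<open>1 - e\<close>
    moves it off the wall to either side, and for small positive \<open>e\<close> it stays in the
    open set \<open>W\<close>.\<close>
  have near: "y \<in> closure r \<inter> closure (cell E q A')"
    if y: "y \<in> nonsink_space q" "y \<in> W" "wall p0 \<bullet> y = 1" for y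
  proof -
    have pos: "eventually (\<lambda>e::real. 0 < e) (at_right 0)"
      by (simp add: eventually_at_right_less)
    have sub: "c *\<^sub>R y \<in> nonsink_space q" for c
      using y(1) by (simp add: nonsink_space_def)
    have "((\<lambda>e. (1 + e) *\<^sub>R y) \<longlongrightarrow> (1 + 0) *\<^sub>R y) (at_right 0)"
      by (intro tendsto_intros)
    then have lim: "((\<lambda>e. (1 + e) *\<^sub>R y) \<longlongrightarrow> y) (at_right 0)" by simp
    have "eventually (\<lambda>e. (1 + e) *\<^sub>R y \<in> W) (at_right 0)"
      by (rule topological_tendstoD [OF lim open_W y(2)])
    with pos have "eventually (\<lambda>e. (1 + e) *\<^sub>R y \<in> closure r) (at_right 0)"
      by eventually_elim (intro subsetD [OF closure_subset] above, simp_all add: sub y(3))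
    from Lim_in_closed_set [OF closed_closure this _ lim] have "y \<in> closure r" by simp
    have "((\<lambda>e. (1 - e) *\<^sub>R y) \<longlongrightarrow> (1 - 0) *\<^sub>R y) (at_right 0)"
      by (intro tendsto_intros)
    then have lim: "((\<lambda>e. (1 - e) *\<^sub>R y) \<longlongrightarrow> y) (at_right 0)" by simp
    have "eventually (\<lambda>e. (1 - e) *\<^sub>R y \<in> W) (at_right 0)"
      by (rule topological_tendstoD [OF lim open_W y(2)])
    with pos have "eventually (\<lambda>e. (1 - e) *\<^sub>R y \<in> closure (cell E q A')) (at_right 0)"
      by eventually_elim (intro subsetD [OF closure_subset] below, simp_all add: sub y(3))
    from Lim_in_closed_set [OF closed_closure this _ lim] have "y \<in> closure (cell E q A')" by simp
    with \<open>y \<in> closure r\<close> show ?thesis ..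
  qed
  from near [OF z_sub \<open>z \<in> W\<close> z_wall] have "cell E q A' \<noteq> {}" by auto
  then have r': "cell E q A' \<in> regions E q" and r'_arcs: "region_arcs E q (cell E q A') = A'"
    using A' by (simp_all add: cell_in_regions region_arcs_cell)
  let ?F = "closure (cell E q A') \<inter> closure r" and ?H = "nonsink_space q \<inter> {x. wall p0 \<bullet> x = 1}"
  have p0_ne: "fst p0 \<noteq> q" "snd p0 \<noteq> q" "fst p0 \<noteq> snd p0"
    using p0_P by (auto simp: nonsink_pairs_def)
  \<comment> \<open>The part of the wall inside the open set \<open>W\<close> is nonempty, hence has
    the full dimension of the wall; it lies in the intersection of the closures, which in turn lies
    in the wall.\<close>
  have "aff_dim (?H \<inter> W) = aff_dim ?H"
  proof (rule aff_dim_convex_Int_open)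
    show "convex ?H" using aff_dim_wall(2) [OF p0_ne] by (rule affine_imp_convex)
    show "open W" by (rule open_W)
    show "?H \<inter> W \<noteq> {}" using z_sub z_wall \<open>z \<in> W\<close> by blast
  qed
  moreover have "aff_dim (?H \<inter> W) \<le> aff_dim ?F"
    using near by (intro aff_dim_subset) auto
  moreover have "aff_dim ?F \<le> aff_dim ?H"
  proof (intro aff_dim_subset subsetI)
    fix y assume y: "y \<in> ?F"
    have "1 \<le> wall p0 \<bullet> v" if "v \<in> r" for v
      using that p0(1) by (force simp: region_arcs_def)
    then have "1 \<le> wall p0 \<bullet> y"
      using y closure_halfspace(2) by (metis IntD2)
    moreover have "wall p0 \<bullet> v \<le> 1" if "v \<in> cell E q A'" for v
      using that p0_P by (force simp: cell_def mem_open_cell_iff A'_def)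
    then have "wall p0 \<bullet> y \<le> 1"
      using y closure_halfspace(1) by (metis IntD1)
    ultimately show "y \<in> ?H"
      using y closure_region_subset [OF r] by auto
  qed
  ultimately have "aff_dim ?F = aff_dim (nonsink_space q) - 1"
    using aff_dim_wall(1) [OF p0_ne] by simp
  moreover have "cell E q A' \<noteq> r"
    using r'_arcs p0(1) by (auto simp: A'_def)
  ultimately have "bordering q (cell E q A') r"
    by (simp add: bordering_def)
  moreover have "p0 \<notin> A'" "?A = insert p0 A'"
    using p0(1) by (auto simp: A'_def)
  ultimately show thesis
    using that r' r'_arcs by metis
qed

section \<open>The labeling algorithm\<close>

definition indegree_label :: "'v::finite set set \<Rightarrow> 'v \<Rightarrow> (real ^ 'v) set \<Rightarrow> int ^ 'v" where
  "indegree_label E q r = central_label E q + (\<Sum>p\<in>region_arcs E q r. axis (snd p) 1)"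

definition region_level :: "'v::finite set set \<Rightarrow> 'v \<Rightarrow> (real ^ 'v) set \<Rightarrow> nat" where
  "region_level E q r = card (region_arcs E q r)"

text \<open>
  The queue is processed in order of increasing level, so a region that is still unlabeled when
  a region bordering it is processed lies on a strictly higher level.
\<close>

definition ps_invariant :: "'v::finite set set \<Rightarrow> 'v \<Rightarrow> 'v ps_state \<Rightarrow> bool" where
  "ps_invariant E q = (\<lambda>(Q, L).
     dom L \<subseteq> regions E q \<and> (\<forall>r\<in>dom L. L r = Some (indegree_label E q r)) \<and>
     central_region E q \<in> dom L \<and> set Q \<subseteq> dom L \<and>
     (\<forall>r\<in>dom L - set Q. \<forall>r'\<in>regions E q. bordering q r r' \<longrightarrow> r' \<in> dom L) \<and>
     sorted (map (region_level E q) Q) \<and>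
     (\<forall>r\<in>set Q. region_level E q r \<le> Suc (region_level E q (hd Q))))"

lemma ps_invariant_init: "ps_invariant E q (ps_init E q)"
proof -
  let ?c = "central_region E q"
  define L where "L = [?c \<mapsto> central_label E q]"
  have L: "dom L = {?c}" "L ?c = Some (indegree_label E q ?c)"
    by (simp_all add: L_def indegree_label_def central_region(2))
  have "ps_init E q = ([?c], L)"
    by (simp add: ps_init_def L_def)
  then show ?thesis
    using L central_region(1) [of E q] by (simp add: ps_invariant_def)
qed

text \<open>Induction on the level: a region that is not central borders one of the next lower
  level, which is labeled and, lying strictly below the queue, already processed; hence all regions
  bordering it are labeled. For an empty queue this covers every region.\<close>

lemma ps_invariant_labeled:
  assumes inv: "ps_invariant E q (Q, L)" and "r \<in> regions E q"
    and "\<And>s. s \<in> set Q \<Longrightarrow> region_level E q r \<le> region_level E q s"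
  shows "r \<in> dom L"
  using assms(2,3)
proof (induction "region_level E q r" arbitrary: r rule: less_induct)
  case less
  show ?case
  proof (cases "region_arcs E q r = {}")
    case True
    then have "r = central_region E q"
      using regions_eqI less.prems(1) central_region by metis
    with inv show ?thesis by (simp add: ps_invariant_def)
  next
    case False
    then obtain r' p where r': "r' \<in> regions E q" "bordering q r' r"
      and p: "p \<notin> region_arcs E q r'" "region_arcs E q r = insert p (region_arcs E q r')"
      using lower_bordering_region [OF less.prems(1)] by blast
    from p have lt: "region_level E q r' < region_level E q r"
      by (simp add: region_level_def)
    with less.prems(2) have below: "region_level E q r' < region_level E q s" if "s \<in> set Q" for s
      using that less_le_trans by blast
    then have "r' \<notin> set Q" by blast
    moreover have "r' \<in> dom L"
      using less.hyps [OF lt r'(1)] below less_imp_le by blast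
    ultimately show ?thesis
      using inv r'(2) less.prems(1) by (auto simp: ps_invariant_def)
  qed
qed

lemma ps_invariant_step:
  assumes "ps_step E q s s'" "ps_invariant E q s"
  shows "ps_invariant E q s'"
  using assms(1)
proof cases
  case (1 rs r L Q)
  define L' where "L' = (\<lambda>r'. if r' \<in> set rs
      then Some (the (L r) + axis (snd (crossing_pair q r r')) 1) else L r')"
  have s': "s' = (Q @ rs, L')" by (simp add: 1 L'_def)
  have inv: "ps_invariant E q (r # Q, L)" using assms(2) 1(1) by simp
  have dom: "dom L \<subseteq> regions E q" "\<forall>r\<in>dom L. L r = Some (indegree_label E q r)"
    and central: "central_region E q \<in> dom L" and Q: "set (r # Q) \<subseteq> dom L"
    and closed: "\<forall>s\<in>dom L - set (r # Q). \<forall>s'\<in>regions E q. bordering q s s' \<longrightarrow> s' \<in> dom L"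
    and sorted: "sorted (map (region_level E q) (r # Q))"
    and levels: "\<forall>s\<in>set (r # Q). region_level E q s \<le> Suc (region_level E q r)"
    using inv unfolding ps_invariant_def prod.case list.sel by blast+
  have r: "r \<in> regions E q" "L r = Some (indegree_label E q r)"
    using Q dom by auto
  \<comment> \<open>A new region one level lower would satisfy the bound in
    \<open>ps_invariant_labeled\<close>, since the head \<open>r\<close> has the least level in the
    queue, and would be labeled already.\<close>
  have up: "\<exists>p. p \<notin> region_arcs E q r \<and> region_arcs E q r' = insert p (region_arcs E q r)"
    if "r' \<in> set rs" for r'
  proof (rule ccontr)
    assume no: "\<not> ?thesis"
    have r': "r' \<in> regions E q" "bordering q r r'" "L r' = None"
      using that 1(4) by auto
    with no r(1) obtain p where "p \<notin> region_arcs E q r'" "region_arcs E q r = insert p (region_arcs E q r')"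
      using bordering_region_arcs by metis
    then have "region_level E q r' \<le> region_level E q r"
      by (simp add: region_level_def)
    then have "r' \<in> dom L"
      using sorted by (intro ps_invariant_labeled [OF inv r'(1)]) force
    with r'(3) show False by blast
  qed
  have rs: "r' \<in> regions E q" "L' r' = Some (indegree_label E q r')"
    "region_level E q r' = Suc (region_level E q r)" if r': "r' \<in> set rs" for r'
  proof -
    show reg: "r' \<in> regions E q" using r' 1(4) by auto
    have b: "bordering q r r'" using r' 1(4) by auto
    obtain p where p: "p \<notin> region_arcs E q r" "region_arcs E q r' = insert p (region_arcs E q r)"
      using up [OF r'] by blast
    show "region_level E q r' = Suc (region_level E q r)"
      using p by (simp add: region_level_def)
    have "crossing_pair q r r' = p"
      using crossing_pair_eq [OF r(1) reg b p] .
    with p r' r(2) show "L' r' = Some (indegree_label E q r')"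
      by (simp add: L'_def indegree_label_def add.commute add.left_commute)
  qed
  have dom_L': "dom L' = dom L \<union> set rs"
    by (auto simp: L'_def dom_def)
  have "dom L' \<subseteq> regions E q"
    using dom_L' dom(1) rs(1) by blast
  moreover have "L' s = Some (indegree_label E q s)" if "s \<in> dom L'" for s
    using that dom(2) rs(2) dom_L' by (cases "s \<in> set rs") (auto simp: L'_def)
  moreover have "set (Q @ rs) \<subseteq> dom L'"
    using Q dom_L' by auto
  moreover have "t \<in> dom L'"
    if "s \<in> dom L' - set (Q @ rs)" "t \<in> regions E q" "bordering q s t" for s t
  proof (cases "s = r")
    case True
    with that 1(4) show ?thesis unfolding dom_L' by auto
  next
    case False
    with that(1) have "s \<in> dom L - set (r # Q)" by (auto simp: dom_L')
    with closed that(2,3) have "t \<in> dom L" by blast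
    then show ?thesis by (simp add: dom_L')
  qed
  \<comment> \<open>The new regions are all one level above \<open>r\<close>, and no queued region
    is higher, so appending them preserves the order.\<close>
  moreover have "sorted (map (region_level E q) (Q @ rs))"
  proof -
    have "map (region_level E q) rs = replicate (length rs) (Suc (region_level E q r))"
      using rs(3) by (simp add: map_replicate_const [symmetric])
    then show ?thesis
      using sorted levels rs(3) by (simp add: sorted_append)
  qed
  moreover have "region_level E q s \<le> Suc (region_level E q (hd (Q @ rs)))" if "s \<in> set (Q @ rs)" for s
  proof -
    have "region_level E q s \<le> Suc (region_level E q r)"
      using that levels rs(3) by auto
    moreover have "hd (Q @ rs) \<in> set (Q @ rs)"
      using that by (intro hd_in_set) auto
    then have "region_level E q r \<le> region_level E q (hd (Q @ rs))"
      using sorted rs(3) by auto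
    ultimately show ?thesis by simp
  qed
  ultimately show ?thesis
    unfolding s' ps_invariant_def using central dom_L' by auto
qed

lemma ps_invariant_steps:
  assumes "(ps_step E q)\<^sup>*\<^sup>* (ps_init E q) s"
  shows "ps_invariant E q s"
  using assms
proof (induction rule: rtranclp_induct)
  case base
  show ?case by (rule ps_invariant_init)
next
  case (step s s')
  from step.hyps(2) step.IH show ?case by (rule ps_invariant_step)
qed

text \<open>The measure is the number of unlabeled regions plus the queue length. Labeling a region
  and queueing it leaves the sum unchanged, and removing the head lowers it by one.\<close>

lemma ps_terminates: "\<exists>L. (ps_step E q)\<^sup>*\<^sup>* s ([], L)"
proof (induction "card (regions E q - dom (snd s)) + length (fst s)" arbitrary: s rule: less_induct)
  case less
  show ?case
  proof (cases s)
    case (Pair Q L)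
    show ?thesis
    proof (cases Q)
      case Nil
      with Pair show ?thesis by blast
    next
      case (Cons r Q')
      let ?N = "{r' \<in> regions E q. bordering q r r' \<and> L r' = None}"
      obtain rs where rs: "distinct rs" "set rs = ?N"
        using finite_distinct_list [of ?N] finite_subset [OF _ finite_regions [of E q], of ?N]
        by auto
      define L' where "L' = (\<lambda>r'. if r' \<in> set rs
          then Some (the (L r) + axis (snd (crossing_pair q r r')) 1) else L r')"
      have step: "ps_step E q s (Q' @ rs, L')"
        unfolding Pair Cons L'_def by (rule ps_step.intros) (fact rs)+
      have "regions E q - dom L' = (regions E q - dom L) - set rs"
        by (auto simp: L'_def dom_def)
      moreover have "set rs \<subseteq> regions E q - dom L"
        using rs(2) by auto
      ultimately have "card (regions E q - dom L') + length rs = card (regions E q - dom L)"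
        using rs(1) finite_regions [of E q]
        by (simp add: card_Diff_subset card_mono distinct_card [symmetric])
      then have "card (regions E q - dom (snd (Q' @ rs, L'))) + length (fst (Q' @ rs, L'))
          < card (regions E q - dom (snd s)) + length (fst s)"
        by (simp add: Pair Cons)
      from less [OF this] step show ?thesis
        by (meson converse_rtranclp_into_rtranclp)
    qed
  qed
qed

text \<open>The invariant at an empty queue forces the same labeling on every completed run,
  whatever the order of queueing; with termination this makes the definite description in
  \<open>final_labeling\<close> well defined.\<close>

lemma pak_stanley_label_eq:
  assumes "r \<in> regions E q"
  shows "pak_stanley_label E q r = indegree_label E q r"
proof -
  have final: "L = (\<lambda>r. if r \<in> regions E q then Some (indegree_label E q r) else None)"
    if "(ps_step E q)\<^sup>*\<^sup>* (ps_init E q) ([], L)" for L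
  proof -
    have inv: "ps_invariant E q ([], L)"
      using that by (rule ps_invariant_steps)
    have "dom L = regions E q"
      using inv ps_invariant_labeled [OF inv] by (auto simp: ps_invariant_def)
    then show ?thesis
      using inv by (fastforce simp: ps_invariant_def)
  qed
  moreover obtain L where "(ps_step E q)\<^sup>*\<^sup>* (ps_init E q) ([], L)"
    using ps_terminates by blast
  ultimately have "final_labeling E q = (\<lambda>r. if r \<in> regions E q then Some (indegree_label E q r) else None)"
    unfolding final_labeling_def by (metis (no_types, lifting) the_equality)
  with assms show ?thesis
    by (simp add: pak_stanley_label_def)
qed

section \<open>Admissible regions and superstable configurations\<close>

lemma mem_arcs_iff:
  assumes "simple_graph E"
  shows "(i, v) \<in> arcs E q x \<longleftrightarrow> i \<noteq> q \<and> v \<noteq> q \<and> {i, v} \<in> E \<and> x $ i + 1 < x $ v"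
  using edge_neq [OF assms, of i v] by (auto simp: arcs_def nonsink_pairs_def inner_wall)

text \<open>Off the walls, admissibility depends only on the arcs: each nonsink vertex not adjacent
  to \<open>q\<close> must receive one. So the admissible part is a union of cells, and admissible
  regions are regions.\<close>

lemma admissible_regions_eq:
  fixes E :: "'v::finite set set"
  assumes "simple_graph E"
  shows "admissible_regions E q = (\<lambda>x. cell E q (arcs E q x)) `
    {x \<in> wall_complement E q. \<forall>i. i \<noteq> q \<longrightarrow> {i, q} \<notin> E \<longrightarrow> (\<exists>j. (j, i) \<in> arcs E q x)}"
proof -
  have adm: "x \<in> admissible_space E q \<longleftrightarrow> x \<in> nonsink_space q \<and>
      (\<forall>i. i \<noteq> q \<longrightarrow> {i, q} \<notin> E \<longrightarrow> (\<exists>j. (j, i) \<in> arcs E q x))" for x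
  proof -
    \<comment> \<open>A witness \<open>j\<close> is never the sink, because \<open>{i, q}\<close> is
      not an edge.\<close>
    have "(\<exists>j. {i, j} \<in> E \<and> x $ i > x $ j + 1) \<longleftrightarrow> (\<exists>j. (j, i) \<in> arcs E q x)"
      if "i \<noteq> q" "{i, q} \<notin> E" for i
      using that unfolding mem_arcs_iff [OF assms] by (metis insert_commute)
    moreover have "x \<in> admissible_space E q \<longleftrightarrow> x \<in> nonsink_space q \<and>
        (\<forall>i. i \<noteq> q \<longrightarrow> {i, q} \<notin> E \<longrightarrow> (\<exists>j. {i, j} \<in> E \<and> x $ i > x $ j + 1))"
      unfolding admissible_space_def Int_iff INT_iff by auto
    ultimately show ?thesis by simp
  qed
  have "admissible_space E q - \<Union>(semiorder_arrangement E q) =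
      admissible_space E q \<inter> wall_complement E q"
    unfolding wall_complement_eq [symmetric] by (auto simp: admissible_space_def)
  also have "\<dots> = {x \<in> wall_complement E q.
      \<forall>i. i \<noteq> q \<longrightarrow> {i, q} \<notin> E \<longrightarrow> (\<exists>j. (j, i) \<in> arcs E q x)}"
    using adm by (auto simp: wall_complement_def)
  finally show ?thesis
    unfolding admissible_regions_def
    by (simp only:) (rule components_eq_cells, auto simp: mem_cell_iff [OF arcs_subset])
qed

lemma indegree_label_cell:
  assumes "simple_graph E" "x \<in> wall_complement E q"
  shows "indegree_label E q (cell E q (arcs E q x)) $ v =
    (if {v, q} \<in> E then 0 else -1) + int (card {i. (i, v) \<in> arcs E q x})"
proof -
  have "x \<in> cell E q (arcs E q x)"
    using assms(2) by (simp add: mem_cell_iff [OF arcs_subset])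
  then have "region_arcs E q (cell E q (arcs E q x)) = arcs E q x"
    by (intro region_arcs_cell arcs_subset) blast
  moreover have "(\<Sum>p\<in>arcs E q x. axis (snd p) 1) $ v = int (card {i. (i, v) \<in> arcs E q x})"
  proof -
    have "(\<Sum>p\<in>arcs E q x. axis (snd p) 1) $ v =
        (\<Sum>p\<in>arcs E q x. if snd p = v then 1 else (0::int))"
      by (auto simp: axis_def intro: sum.cong)
    also have "\<dots> = int (card (arcs E q x \<inter> {p. snd p = v}))"
      by (subst sum.If_cases) simp_all
    also have "arcs E q x \<inter> {p. snd p = v} = (\<lambda>i. (i, v)) ` {i. (i, v) \<in> arcs E q x}"
      by auto
    also have "card \<dots> = card {i. (i, v) \<in> arcs E q x}"
      by (intro card_image) (simp add: inj_on_def)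
    finally show ?thesis .
  qed
  ultimately show ?thesis
    by (simp add: indegree_label_def central_label_def)
qed

text \<open>For a nonsink vertex not adjacent to \<open>q\<close>, admissibility yields an incoming
  arc that makes up for the -1 in the central label. Adding \<open>axis q 1\<close> cancels the -1
  at the sink, which receives no arcs.\<close>

lemma superstable_indegree_label:
  fixes E :: "'v::finite set set"
  assumes simple: "simple_graph E" and x: "x \<in> wall_complement E q"
    and adm: "\<forall>i. i \<noteq> q \<longrightarrow> {i, q} \<notin> E \<longrightarrow> (\<exists>j. (j, i) \<in> arcs E q x)"
  shows "superstable E q (indegree_label E q (cell E q (arcs E q x)) + axis q 1)"
    (is "superstable E q ?c")
proof -
  have c: "?c $ v = (if {v, q} \<in> E then 0 else -1) + int (card {i. (i, v) \<in> arcs E q x})"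
    if "v \<noteq> q" for v
    using that by (simp add: indegree_label_cell [OF simple x] axis_def)
  have "{q, q} \<notin> E" using edge_neq [OF simple] by blast
  then have c_q: "?c $ q = 0"
    by (simp add: indegree_label_cell [OF simple x] mem_arcs_iff [OF simple])
  have "0 \<le> ?c $ v" for v
  proof (cases "v = q \<or> {v, q} \<in> E")
    case True
    then show ?thesis using c_q c [of v] by (cases "v = q") auto
  next
    case False
    with adm have "{i. (i, v) \<in> arcs E q x} \<noteq> {}" by blast
    then have "0 < card {i. (i, v) \<in> arcs E q x}" by (simp add: card_gt_0_iff)
    with False show ?thesis using c [of v] by simp
  qed
  moreover have "\<exists>v\<in>Y. ?c $ v < int (card {w. w \<notin> Y \<and> {v, w} \<in> E})"
    if Y: "Y \<noteq> {}" "Y \<subseteq> - {q}" for Y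
  proof -
    obtain v where "is_arg_min (($) x) (\<lambda>v. v \<in> Y) v"
      using ex_is_arg_min_if_finite [of Y "($) x"] Y(1) by auto
    then have v: "v \<in> Y" "\<And>i. i \<in> Y \<Longrightarrow> x $ v \<le> x $ i"
      by (auto simp: is_arg_min_linorder)
    let ?O = "{w. w \<notin> Y \<and> {v, w} \<in> E}"
    have "i \<in> ?O - {q}" if "(i, v) \<in> arcs E q x" for i
      using that v(2) [of i] by (auto simp: mem_arcs_iff [OF simple] insert_commute)
    then have le: "card {i. (i, v) \<in> arcs E q x} \<le> card (?O - {q})"
      by (intro card_mono) auto
    have "v \<noteq> q" using v(1) Y(2) by blast
    \<comment> \<open>The strict inequality has two sources: a neighbour \<open>q\<close> outside
      \<open>Y\<close> that sends no arc, or the -1 in the central label.\<close>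
    have "?c $ v < int (card ?O)"
    proof (cases "{v, q} \<in> E")
      case True
      then have "q \<in> ?O" using Y(2) by blast
      then have "card (?O - {q}) < card ?O" by (intro card_Diff1_less) auto
      with le True c [OF \<open>v \<noteq> q\<close>] show ?thesis by simp
    next
      case False
      have "card (?O - {q}) \<le> card ?O" by (intro card_mono) auto
      with le False c [OF \<open>v \<noteq> q\<close>] show ?thesis by simp
    qed
    with v(1) show ?thesis ..
  qed
  ultimately show ?thesis
    using c_q by (simp add: superstable_iff [OF simple])
qed

lemma superstable_realization:
  fixes E :: "'v::finite set set"
  assumes simple: "simple_graph E" and ss: "superstable E q c"
  obtains x where "x \<in> wall_complement E q"
    and "\<forall>i. i \<noteq> q \<longrightarrow> {i, q} \<notin> E \<longrightarrow> (\<exists>j. (j, i) \<in> arcs E q x)"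
    and "indegree_label E q (cell E q (arcs E q x)) = c - axis q 1"
proof -
  have c_q: "c $ q = 0" and c_nonneg: "\<And>v. 0 \<le> c $ v"
    and c_stable: "\<And>Y. Y \<noteq> {} \<Longrightarrow> Y \<subseteq> - {q} \<Longrightarrow>
      \<exists>v\<in>Y. c $ v < int (card {w. w \<notin> Y \<and> {v, w} \<in> E})"
    using ss by (simp_all add: superstable_iff [OF simple])
  \<comment> \<open>On nonsink vertices \<open>d\<close> is the indegree that turns the central
    label into \<open>c\<close>: those not adjacent to \<open>q\<close> start at -1 and need one
    more arc.\<close>
  define d where "d v = nat (c $ v) + (if {v, q} \<in> E then 0 else 1)" for v
  \<comment> \<open>The strict inequality of superstability becomes a weak one for \<open>d\<close>:
    either the neighbour \<open>q\<close> is dropped from the count, or \<open>d v\<close> exceeds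
    \<open>c $ v\<close> by one.\<close>
  have d_stable: "\<exists>v\<in>Y. d v \<le> card {i \<in> - {q} - Y. {i, v} \<in> E}" if Y: "Y \<noteq> {}" "Y \<subseteq> - {q}" for Y
  proof -
    obtain v where v: "v \<in> Y" and lt: "c $ v < int (card {w. w \<notin> Y \<and> {v, w} \<in> E})"
      using c_stable [OF Y] ..
    have eq: "{i \<in> - {q} - Y. {i, v} \<in> E} = {w. w \<notin> Y \<and> {v, w} \<in> E} - {q}"
      by (auto simp: insert_commute)
    have "d v \<le> card {i \<in> - {q} - Y. {i, v} \<in> E}"
    proof (cases "{v, q} \<in> E")
      case True
      then have "q \<in> {w. w \<notin> Y \<and> {v, w} \<in> E}" using Y(2) by blast
      then have "card {w. w \<notin> Y \<and> {v, w} \<in> E} = Suc (card ({w. w \<notin> Y \<and> {v, w} \<in> E} - {q}))"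
        by (intro card.remove) auto
      with lt True show ?thesis unfolding eq by (simp add: d_def)
    next
      case False
      then have "{w. w \<notin> Y \<and> {v, w} \<in> E} - {q} = {w. w \<notin> Y \<and> {v, w} \<in> E}" by blast
      with lt False c_nonneg [of v] show ?thesis unfolding eq by (simp add: d_def)
    qed
    with v show ?thesis ..
  qed
  obtain x :: "'v \<Rightarrow> real"
    where x: "\<forall>v\<in>- {q}. card {i \<in> - {q}. {i, v} \<in> E \<and> x i + 1 < x v} = d v"
    and x_off: "\<forall>v\<in>- {q}. \<forall>i\<in>- {q}. {i, v} \<in> E \<longrightarrow> x v \<noteq> x i + 1"
    using sweep_realization [OF simple d_stable] .
  define X where "X = (\<chi> v. if v = q then 0 else x v)"
  have X_wc: "X \<in> wall_complement E q"
  proof -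
    have "x v - x i \<noteq> 1" if "v \<noteq> q" "i \<noteq> q" "{i, v} \<in> E" for v i
      using x_off that by force
    then show ?thesis
      by (auto simp: wall_complement_def nonsink_space_def nonsink_pairs_def inner_wall X_def)
  qed
  have deg: "card {i. (i, v) \<in> arcs E q X} = d v" if "v \<noteq> q" for v
  proof -
    have "{i. (i, v) \<in> arcs E q X} = {i \<in> - {q}. {i, v} \<in> E \<and> x i + 1 < x v}"
      using that by (auto simp: mem_arcs_iff [OF simple] X_def)
    with x that show ?thesis by simp
  qed
  show thesis
  proof
    show "X \<in> wall_complement E q" by (fact X_wc)
    show "\<forall>i. i \<noteq> q \<longrightarrow> {i, q} \<notin> E \<longrightarrow> (\<exists>j. (j, i) \<in> arcs E q X)"
    proof (intro allI impI)
      \<comment> \<open>The demand of a vertex not adjacent to \<open>q\<close> is at least one,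
        which gives admissibility.\<close>
      fix i assume "i \<noteq> q" "{i, q} \<notin> E"
      then have "card {j. (j, i) \<in> arcs E q X} \<noteq> 0"
        by (simp add: deg d_def)
      then show "\<exists>j. (j, i) \<in> arcs E q X"
        by (auto simp: card_eq_0_iff)
    qed
    have "{q, q} \<notin> E" using edge_neq [OF simple] by blast
    moreover have "(i, q) \<notin> arcs E q X" for i
      by (simp add: mem_arcs_iff [OF simple])
    ultimately have "indegree_label E q (cell E q (arcs E q X)) $ v = (c - axis q 1) $ v" for v
      using c_q c_nonneg [of v]
      by (cases "v = q")
        (simp_all add: indegree_label_cell [OF simple X_wc] deg d_def axis_def)
    then show "indegree_label E q (cell E q (arcs E q X)) = c - axis q 1"
      by (simp add: vec_eq_iff)
  qed
qed

theorem theorem4p11: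
  fixes E :: "'v::finite set set" and q :: 'v
  assumes "simple_graph E" and "connected_graph E"
  shows "pak_stanley_label E q ` admissible_regions E q = S0_tilde E q
       \<and> S0_tilde E q = {c - axis q 1 | c. superstable E q c}"
proof -
  \<comment> \<open>\<open>X\<close> consists of the points of the admissible space off the walls,
    so that labels are indexed by points instead of regions.\<close>
  define X where "X = {x \<in> wall_complement E q.
    \<forall>i. i \<noteq> q \<longrightarrow> {i, q} \<notin> E \<longrightarrow> (\<exists>j. (j, i) \<in> arcs E q x)}"
  have "cell E q (arcs E q x) \<in> regions E q" if "x \<in> X" for x
    using that by (auto simp: X_def regions_eq)
  then have "pak_stanley_label E q ` admissible_regions E q =
      (\<lambda>x. indegree_label E q (cell E q (arcs E q x))) ` X"
    unfolding admissible_regions_eq [OF assms(1)] X_def [symmetric] image_image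
    by (intro image_cong) (simp_all add: pak_stanley_label_eq)
  also have "\<dots> = {c - axis q 1 | c. superstable E q c}"
  proof (intro equalityI subsetI)
    fix c assume "c \<in> (\<lambda>x. indegree_label E q (cell E q (arcs E q x))) ` X"
    then have "superstable E q (c + axis q 1)"
      using superstable_indegree_label [OF assms(1)] by (auto simp: X_def)
    moreover have "c = (c + axis q 1) - axis q 1" by simp
    ultimately show "c \<in> {c - axis q 1 | c. superstable E q c}" by blast
  next
    fix c assume "c \<in> {c - axis q 1 | c. superstable E q c}"
    then obtain c' where c': "superstable E q c'" "c = c' - axis q 1" by blast
    obtain x where "x \<in> X" "indegree_label E q (cell E q (arcs E q x)) = c"
      using superstable_realization [OF assms(1) c'(1)] c'(2) unfolding X_def by blast
    then show "c \<in> (\<lambda>x. indegree_label E q (cell E q (arcs E q x))) ` X" by blast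
  qed
  finally show ?thesis
    using S0_tilde_eq [OF assms(1)] by blast
qed

end
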